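(* Let $G$ be a graph without isolated vertices, with degree sequence $\pi$. Then $G$ is a pseudo-split graph if and only if $\beta(\pi)\succeq\alpha(\pi)$ or the following four conditions are all satisfied: (i) $\alpha(\pi)$ ends in $2,1$ (its smallest two parts are $2$ and $1$); (ii) $\beta(\pi)$ ends in $4,3$ (its smallest two parts are $4$ and $3$); (iii) $\mathrm{len}(\alpha(\pi))=\mathrm{len}(\beta(\pi))$; (iv) $\tilde\beta\succeq\tilde\alpha$, where $\tilde\beta$ is $\beta(\pi)$ with the smallest two parts removed and $\tilde\alpha$ is $\alpha(\pi)$ with the smallest two parts removed.
   Context: Graphs are finite and simple, with at least one vertex. Degree sequences are written $\pi=(d_1\ge\dots\ge d_r)$. $\alpha(\pi)$ is the partition with $i$-th part $d_i-i+1$ for those $i$ with $d_i\ge i$ (row lengths of the Ferrers diagram of $\pi$ starting at and including the main diagonal); $\beta(\pi)$ is the partition with $j$-th part $|\{i:d_i\ge j\}|-j$ for those $j$ for which this is positive (column lengths below the main diagonal). Both have distinct parts, in decreasing order; $\mathrm{len}$ is the number of parts. For partitions $\delta=(\delta_1,\dots,\delta_s)$ and $\gamma=(\gamma_1,\dots,\gamma_t)$ (possibly empty), $\delta\succeq\gamma$ ($\delta$ majorizes $\gamma$) means that $\delta$ and $\gamma$ partition the same integer and $\sum_{i=1}^m\delta_i\ge\sum_{i=1}^m\gamma_i$ for all $m\le\min\{s,t\}$. A graph is a pseudo-split graph if it contains neither $C_4$ nor $2K_2$ as an induced subgraph. *)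

theory Defs
  imports
    "Graph_Theory.Digraph_Component"
    "Graph_Theory.Digraph_Isomorphism"
    "Graph_Theory.Pair_Digraph"
    "HOL-Library.Multiset"
    "HOL-Library.Sublist"
begin

text \<open>
  Finite simple graphs are modelled by the locale \<open>graph\<close>: finite, loop-free, symmetric digraphs
  without parallel arcs. An edge \<open>uv\<close> is a pair of opposite arcs, so the degree of a vertex is
  its \<open>out_degree\<close>.
\<close>

definition contains_induced :: "('a,'b) pre_digraph \<Rightarrow> ('c,'d) pre_digraph \<Rightarrow> bool" where
  "contains_induced G F \<longleftrightarrow> (\<exists>H. induced_subgraph H G \<and> digraph_iso H F)"

definition C4 :: "(nat, nat \<times> nat) pre_digraph" where
  "C4 = with_proj \<lparr> pverts = {0,1,2,3},
     parcs = {(0,1),(1,0),(1,2),(2,1),(2,3),(3,2),(3,0),(0,3)} \<rparr>"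

definition two_K2 :: "(nat, nat \<times> nat) pre_digraph" where
  "two_K2 = with_proj \<lparr> pverts = {0,1,2,3}, parcs = {(0,1),(1,0),(2,3),(3,2)} \<rparr>"

definition pseudo_split :: "('a,'b) pre_digraph \<Rightarrow> bool" where
  "pseudo_split G \<longleftrightarrow> \<not> contains_induced G C4 \<and> \<not> contains_induced G two_K2"

definition degree_seq :: "('a,'b) pre_digraph \<Rightarrow> nat list" where
  "degree_seq G =
     rev (sorted_list_of_multiset (image_mset (out_degree G) (mset_set (verts G))))"

text \<open>
  In the next two definitions \<open>i\<close> and \<open>j\<close> count from \<open>1\<close>, so the \<open>i\<close>-th degree is \<open>d ! (i - 1)\<close>.
  The filters make the subtractions on \<open>nat\<close> exact. In \<open>beta_partition\<close>, column lengths are at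
  most \<open>length d\<close>, so no \<open>j > length d\<close> can contribute a part.
\<close>

definition alpha_partition :: "nat list \<Rightarrow> nat list" where
  "alpha_partition d =
     [d ! (i - 1) - i + 1. i \<leftarrow> [1..<Suc (length d)], i \<le> d ! (i - 1)]"

definition col_length :: "nat list \<Rightarrow> nat \<Rightarrow> nat" where
  "col_length d j = card {i \<in> {1..length d}. j \<le> d ! (i - 1)}"

definition beta_partition :: "nat list \<Rightarrow> nat list" where
  "beta_partition d =
     [col_length d j - j. j \<leftarrow> [1..<Suc (length d)], j < col_length d j]"

text \<open>Partitions are decreasing lists of positive parts.\<close>

definition majorizes :: "nat list \<Rightarrow> nat list \<Rightarrow> bool" (infix \<open>\<succeq>\<close> 50) where
  "\<delta> \<succeq> \<gamma> \<longleftrightarrow> sum_list \<delta> = sum_list \<gamma> \<and>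
     (\<forall>m \<le> min (length \<delta>) (length \<gamma>). sum_list (take m \<delta>) \<ge> sum_list (take m \<gamma>))"

definition drop_smallest_two :: "nat list \<Rightarrow> nat list" where
  "drop_smallest_two \<delta> = butlast (butlast \<delta>)"

end

theory Submission
  imports Defs
begin

text \<open>
  A graph without induced \<open>C\<^sub>4\<close> and \<open>2K\<^sub>2\<close> is either a split graph, or a clique \<open>K\<close>, a
  five-cycle \<open>C\<close> and an independent set, where \<open>C\<close> is completely joined to \<open>K\<close> and has no edge to
  the independent set (\<open>forbidden_subgraph_characterization\<close>). The two disjuncts of the criterion
  recognise these two shapes from the degrees.

  The bridge is the Erdos-Gallai inequality for a vertex set \<open>K\<close> with \<open>k\<close> elements,
  \<open>(\<Sum>v\<in>K. deg v) \<le> k * (k - 1) + (\<Sum>v\<in>V - K. min (deg v) k)\<close>, obtained by counting the edges at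
  \<open>K\<close>. Its equality case is structural: \<open>K\<close> is a clique, and every outer vertex is adjacent to all
  of \<open>K\<close> or has all its neighbours in \<open>K\<close> (\<open>erdos_gallai\<close>). If \<open>K\<close> consists of the first \<open>k\<close> vertices
  in order of decreasing degree, and \<open>k\<close> is at most the side \<open>f\<close> of the Durfee square of \<open>\<pi>\<close>, then
  the slack in this inequality is exactly the sum of the first \<open>k\<close> parts of \<open>\<beta>(\<pi>)\<close> minus that of the
  first \<open>k\<close> parts of \<open>\<alpha>(\<pi>)\<close> (\<open>partition_sums_balance\<close>, \<open>partial_sums\<close>). Hence for a degree sequence
  the inequalities in a majorization hold anyway, and only the equality of the two totals says
  something about the graph.

  For the full partitions this is tightness of the first \<open>f\<close> vertices, and it holds if and only if
  the graph is split (\<open>split_iff_majorizes\<close>). In the second disjunct put \<open>q = f - 2\<close>. The required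
  last parts of the partitions say that there are exactly five vertices of degree \<open>q + 2\<close> after the
  first \<open>q\<close>, followed by vertices of degree at most \<open>q\<close>; and the trimmed majorization is tightness
  of the first \<open>q\<close> vertices. Tightness then joins the five vertices to these \<open>q\<close> and cuts
  them off from the rest, so that they induce a 2-regular graph on five vertices
  (\<open>regular_core_iff_trimmed_majorizes\<close>).
\<close>

section \<open>The partitions of a nonincreasing sequence\<close>

lemma down_closed_eq_lessThan:
  fixes S :: "nat set"
  assumes "finite S" and "\<And>i j. i \<in> S \<Longrightarrow> j < i \<Longrightarrow> j \<in> S"
  shows "S = {..<card S}"
proof (cases "S = {}")
  case False
  have "S = {..Max S}"
    using assms False
    by (metis (no_types, lifting) Max_ge Max_in antisym atMost_iff le_neq_implies_less subsetI)
  then show ?thesis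
    by (metis card_atMost lessThan_Suc_atMost)
qed simp

text \<open>
  Both partitions are list comprehensions over \<open>[1..<Suc n]\<close> whose filter selects an initial
  segment, because \<open>i - p ! (i - 1)\<close> and \<open>j - col_length p j\<close> increase. The result is indexed from
  0.
\<close>

lemma comprehension_initial_segment:
  assumes "g \<le> n" and "\<And>i. 1 \<le> i \<Longrightarrow> i \<le> n \<Longrightarrow> P i \<longleftrightarrow> i \<le> g"
  shows "[h i. i \<leftarrow> [1..<Suc n], P i] = map (\<lambda>i. h (Suc i)) [0..<g]"
proof -
  have "[h i. i \<leftarrow> xs, P i] = map h (filter P xs)" for xs
    by (induction xs) auto
  moreover have "filter P [1..<Suc n] = [1..<Suc g]"
  proof -
    have "[1..<Suc n] = [1..<Suc g] @ [Suc g..<Suc n]"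
      using assms(1) upt_add_eq_append[of 1 "Suc g" "n - g"] by simp
    moreover have "filter P [1..<Suc g] = [1..<Suc g]"
      using assms by (intro filter_True) auto
    moreover have "filter P [Suc g..<Suc n] = []"
      using assms by (auto simp: filter_empty_conv)
    ultimately show ?thesis by simp
  qed
  moreover have "map h [1..<Suc g] = map (\<lambda>i. h (Suc i)) [0..<g]"
    by (simp add: map_Suc_upt[symmetric] del: upt_Suc)
  ultimately show ?thesis by simp
qed

lemma sum_list_map_upt: "sum_list (map h [0..<g]) = sum h {..<g}"
  for h :: "nat \<Rightarrow> nat"
  by (simp add: sum_list_sum_nth atLeast0LessThan)

lemma sum_list_take_map_upt: "m \<le> g \<Longrightarrow> sum_list (take m (map h [0..<g])) = sum h {..<m}"
  for h :: "nat \<Rightarrow> nat"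
  by (simp add: take_map sum_list_map_upt del: map_upt_eqI)

locale nonincreasing_list =
  fixes p :: "nat list"
  assumes nonincreasing: "i \<le> j \<Longrightarrow> j < length p \<Longrightarrow> p ! j \<le> p ! i"
begin

abbreviation n :: nat where "n \<equiv> length p"

text \<open>
  The side of the Durfee square of the Ferrers diagram. The selected indices form an initial
  segment, so that counting them gives the first index at which the diagonal leaves the diagram.
\<close>

definition durfee :: nat where
  "durfee = card {i. i < n \<and> i < p ! i}"

lemma durfee_iff: "i < n \<and> i < p ! i \<longleftrightarrow> i < durfee"
proof -
  have "{i. i < n \<and> i < p ! i} = {..<durfee}"
    unfolding durfee_def
  proof (rule down_closed_eq_lessThan)
    fix i j assume "i \<in> {i. i < n \<and> i < p ! i}" "j < i"
    then show "j \<in> {i. i < n \<and> i < p ! i}"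
      using nonincreasing[of j i] by auto
  qed simp
  then show ?thesis by blast
qed

lemma durfee_le: "durfee \<le> n"
  using durfee_iff[of n] by auto

lemma durfee_le_nth: "i < durfee \<Longrightarrow> durfee \<le> p ! i"
  using durfee_iff[of "durfee - 1"] nonincreasing[of i "durfee - 1"] by fastforce

lemma nth_le_durfee: "durfee \<le> i \<Longrightarrow> i < n \<Longrightarrow> p ! i \<le> durfee"
  using durfee_iff[of durfee] nonincreasing[of durfee i] by fastforce

lemma durfee_eqI:
  assumes "f \<le> n" "\<And>i. i < f \<Longrightarrow> f \<le> p ! i" "f < n \<Longrightarrow> p ! f \<le> f"
  shows "durfee = f"
proof (rule antisym)
  show "durfee \<le> f"
    using durfee_iff[of f] assms(3) by (meson leD leI)
  show "f \<le> durfee"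
    using durfee_iff[of "f - 1"] assms(1) assms(2)[of "f - 1"] by (cases f) auto
qed

lemma col_length_eq_card: "col_length p j = card {i. i < n \<and> j \<le> p ! i}"
proof -
  have "{i \<in> {1..n}. j \<le> p ! (i - 1)} = Suc ` {i. i < n \<and> j \<le> p ! i}"
    by (auto simp: image_iff gr0_conv_Suc Suc_le_eq)
  then show ?thesis by (simp add: col_length_def card_image)
qed

lemma col_length_eq_sum: "col_length p j = (\<Sum>i<n. if j \<le> p ! i then 1 else 0)"
proof -
  have "{i. i < n \<and> j \<le> p ! i} = {..<n} \<inter> {i. j \<le> p ! i}" by auto
  then show ?thesis by (simp add: col_length_eq_card sum.If_cases)
qed

text \<open>
  Columns and rows describe the same diagram: the cell in row \<open>i\<close> and column \<open>j\<close>, where rows are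
  counted from 0 and columns from 1, belongs to it if and only if the row reaches the column, or the
  column reaches the row.
\<close>

lemma col_length_iff:
  assumes "i < n"
  shows "j \<le> p ! i \<longleftrightarrow> i < col_length p j"
proof -
  have "{i. i < n \<and> j \<le> p ! i} = {..<col_length p j}"
    unfolding col_length_eq_card
  proof (rule down_closed_eq_lessThan)
    fix i k assume "i \<in> {i. i < n \<and> j \<le> p ! i}" "k < i"
    then show "k \<in> {i. i < n \<and> j \<le> p ! i}"
      using nonincreasing[of k i] by auto
  qed simp
  then show ?thesis using assms by blast
qed

lemma col_length_le: "col_length p j \<le> n"
proof -
  have "col_length p j \<le> card {1..n}"
    unfolding col_length_def by (intro card_mono) auto
  then show ?thesis by simp
qed

lemma alpha_partition_eq: "alpha_partition p = map (\<lambda>i. p ! i - i) [0..<durfee]"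
proof -
  have "alpha_partition p = map (\<lambda>i. p ! (Suc i - 1) - Suc i + 1) [0..<durfee]"
    unfolding alpha_partition_def
    using durfee_le
  proof (rule comprehension_initial_segment)
    fix i assume "1 \<le> i" "i \<le> n"
    then show "i \<le> p ! (i - 1) \<longleftrightarrow> i \<le> durfee"
      using durfee_iff[of "i - 1"] by auto
  qed
  also have "\<dots> = map (\<lambda>i. p ! i - i) [0..<durfee]"
  proof (rule map_cong)
    fix i assume "i \<in> set [0..<durfee]"
    then have "i < p ! i" using durfee_iff[of i] by simp
    then show "p ! (Suc i - 1) - Suc i + 1 = p ! i - i" by simp
  qed simp
  finally show ?thesis .
qed

text \<open>
  If \<open>durfee\<close> is positive, column \<open>durfee\<close> has at least \<open>durfee\<close> cells. If it has no more, it
  contributes no part to \<open>\<beta>\<close>, and there is one part fewer than in \<open>\<alpha>\<close>; the term that the formula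
  would give for this column is then 0, so that sums of the formula over all \<open>durfee\<close> columns are
  still sums of parts.
\<close>

lemma beta_partition_eq:
  obtains g where "beta_partition p = map (\<lambda>j. col_length p (Suc j) - Suc j) [0..<g]"
    and "g = durfee \<or> Suc g = durfee \<and> col_length p durfee = durfee"
proof -
  define g where "g = (if durfee < n \<and> p ! durfee = durfee then durfee else durfee - 1)"
  have "g \<le> n" using durfee_le by (auto simp: g_def)
  have iff: "j < col_length p j \<longleftrightarrow> j \<le> g" if "1 \<le> j" "j \<le> n" for j
  proof (cases "j < n")
    case True
    then have *: "j < col_length p j \<longleftrightarrow> j \<le> p ! j" by (simp add: col_length_iff)
    consider "j < durfee" | "j = durfee" | "durfee < j" by linarith
    then show ?thesis
    proof cases
      case 1
      with durfee_le_nth[of j] * show ?thesis by (auto simp: g_def)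
    next
      case 2
      with * nth_le_durfee[of j] True that show ?thesis by (auto simp: g_def)
    next
      case 3
      with * nth_le_durfee[of j] True show ?thesis by (auto simp: g_def)
    qed
  next
    case False
    with that have "j = n" by simp
    moreover have "\<not> n < col_length p n" using col_length_le[of n] by simp
    moreover have "\<not> n \<le> g" using durfee_le that \<open>j = n\<close> by (auto simp: g_def)
    ultimately show ?thesis by simp
  qed
  have "beta_partition p = map (\<lambda>j. col_length p (Suc j) - Suc j) [0..<g]"
    unfolding beta_partition_def
    using \<open>g \<le> n\<close> iff by (rule comprehension_initial_segment)
  moreover have "g = durfee \<or> Suc g = durfee \<and> col_length p durfee = durfee"
  proof (cases "durfee = g")
    case False
    then have g: "Suc g = durfee" by (auto simp: g_def split: if_splits)
    have "durfee - 1 < n" using durfee_le g by simp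
    then have "durfee - 1 < col_length p durfee"
      using col_length_iff[of "durfee - 1" durfee] durfee_le_nth[of "durfee - 1"] g by simp
    moreover have "\<not> durfee < col_length p durfee"
      using iff[of durfee] g durfee_le by simp
    ultimately show ?thesis using g by linarith
  qed simp
  ultimately show thesis using that by blast
qed

lemma le_col_length:
  assumes "j < durfee"
  shows "Suc j \<le> col_length p (Suc j)"
  using col_length_iff[of j "Suc j"] durfee_le_nth[of j] durfee_le assms by linarith

text \<open>
  Column lengths and row lengths count the same cells: the first \<open>k\<close> columns together have \<open>\<Sum>i<n.
  min (p ! i) k\<close> cells, and the \<open>k\<close> longest rows contribute a full square \<open>k * k\<close> to this. The
  triangular numbers that turn rows and columns into parts of \<open>\<alpha>\<close> and \<open>\<beta>\<close> differ by \<open>k\<close>, because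
  only \<open>\<alpha>\<close> includes the diagonal; this turns \<open>k * k\<close> into \<open>k * (k - 1)\<close>.
\<close>

lemma partition_sums_balance:
  assumes "k \<le> durfee"
  shows "(\<Sum>i<k. p ! i - i) + (k * (k - 1) + (\<Sum>i = k..<n. min (p ! i) k))
       = (\<Sum>j<k. col_length p (Suc j) - Suc j) + (\<Sum>i<k. p ! i)"
proof -
  have kn: "k \<le> n" using assms durfee_le by simp
  have "(\<Sum>i<k. p ! i - i) + (\<Sum>i<k. i) = (\<Sum>i<k. p ! i)"
    unfolding sum.distrib[symmetric]
  proof (rule sum.cong)
    fix i assume "i \<in> {..<k}"
    then have "i < p ! i" using durfee_iff[of i] assms by simp
    then show "p ! i - i + i = p ! i" by simp
  qed simp
  moreover have "(\<Sum>j<k. col_length p (Suc j) - Suc j) + (\<Sum>j<k. Suc j)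
      = k * k + (\<Sum>i = k..<n. min (p ! i) k)"
  proof -
    have "(\<Sum>j<k. col_length p (Suc j) - Suc j) + (\<Sum>j<k. Suc j) = (\<Sum>j<k. col_length p (Suc j))"
      unfolding sum.distrib[symmetric]
    proof (rule sum.cong)
      fix j assume "j \<in> {..<k}"
      then show "col_length p (Suc j) - Suc j + Suc j = col_length p (Suc j)"
        using le_col_length[of j] assms by simp
    qed simp
    also have "\<dots> = (\<Sum>i<n. \<Sum>j<k. if Suc j \<le> p ! i then 1 else 0)"
      unfolding col_length_eq_sum by (rule sum.swap)
    also have "\<dots> = (\<Sum>i<n. min (p ! i) k)"
    proof (rule sum.cong)
      fix i
      have "{..<k} \<inter> {j. Suc j \<le> p ! i} = {..<min (p ! i) k}" by auto
      then show "(\<Sum>j<k. if Suc j \<le> p ! i then 1 else 0) = min (p ! i) k"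
        by (simp add: sum.If_cases)
    qed simp
    also have "\<dots> = (\<Sum>i<k. min (p ! i) k) + (\<Sum>i = k..<n. min (p ! i) k)"
      using kn by (metis atLeast0LessThan le0 sum.atLeastLessThan_concat)
    also have "(\<Sum>i<k. min (p ! i) k) = (\<Sum>i<k. k)"
    proof (rule sum.cong)
      fix i assume "i \<in> {..<k}"
      then show "min (p ! i) k = k"
        using durfee_le_nth[of i] assms by simp
    qed simp
    finally show ?thesis by simp
  qed
  moreover have "(\<Sum>i<k. i) + (\<Sum>j<k. Suc j) = k * k"
    by (induction k) auto
  moreover have "(\<Sum>j<k. Suc j) = (\<Sum>i<k. i) + k"
    by (induction k) auto
  moreover have "k * (k - 1) + k = k * k"
    by (cases k) auto
  ultimately show ?thesis by linarith
qed

definition alpha_sum :: "nat \<Rightarrow> nat" where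
  "alpha_sum k = (\<Sum>i<k. p ! i - i)"

definition beta_sum :: "nat \<Rightarrow> nat" where
  "beta_sum k = (\<Sum>j<k. col_length p (Suc j) - Suc j)"

text \<open>
  Once the partial sums are known to be ordered, majorization is equality of the totals.
\<close>

lemma beta_majorizes_alpha_iff:
  assumes "\<And>k. k \<le> durfee \<Longrightarrow> alpha_sum k \<le> beta_sum k"
  shows "beta_partition p \<succeq> alpha_partition p \<longleftrightarrow> alpha_sum durfee = beta_sum durfee"
proof -
  obtain g where g: "beta_partition p = map (\<lambda>j. col_length p (Suc j) - Suc j) [0..<g]"
    "g = durfee \<or> Suc g = durfee \<and> col_length p durfee = durfee"
    by (rule beta_partition_eq)
  have "beta_sum g = beta_sum durfee"
    using g(2) by (auto simp: beta_sum_def dest: sym)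
  then have sums: "sum_list (alpha_partition p) = alpha_sum durfee"
    "sum_list (beta_partition p) = beta_sum durfee"
    by (simp_all add: g(1) alpha_partition_eq sum_list_map_upt alpha_sum_def beta_sum_def)
  have "sum_list (take m (alpha_partition p)) \<le> sum_list (take m (beta_partition p))"
    if "m \<le> min (length (beta_partition p)) (length (alpha_partition p))" for m
  proof -
    have "m \<le> g" "m \<le> durfee" using that by (simp_all add: g(1) alpha_partition_eq)
    then show ?thesis
      using assms[of m] unfolding g(1) alpha_partition_eq
      by (simp only: sum_list_take_map_upt alpha_sum_def beta_sum_def)
  qed
  then show ?thesis
    unfolding majorizes_def sums by metis
qed

text \<open>
  The shape of the degree sequence when a five-cycle is joined to a clique of size \<open>q\<close>: the vertices
  of the cycle have degree \<open>q + 2\<close>, those of the clique no less, and the remaining ones at most \<open>q\<close>.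
\<close>

definition plateau :: "nat \<Rightarrow> bool" where
  "plateau q \<longleftrightarrow> q + 5 \<le> n \<and> (\<forall>i<q. q + 2 \<le> p ! i)
     \<and> (\<forall>i. q \<le> i \<longrightarrow> i < q + 5 \<longrightarrow> p ! i = q + 2)
     \<and> (\<forall>i. q + 5 \<le> i \<longrightarrow> i < n \<longrightarrow> p ! i \<le> q)"

lemma plateau_partitions:
  assumes "plateau q"
  shows "durfee = q + 2"
    and "alpha_partition p = map (\<lambda>i. p ! i - i) [0..<q] @ [2, 1]"
    and "beta_partition p = map (\<lambda>j. col_length p (Suc j) - Suc j) [0..<q] @ [4, 3]"
proof -
  have n: "q + 5 \<le> n" and hi: "\<And>i. i < q \<Longrightarrow> q + 2 \<le> p ! i"
    and mid: "\<And>i. q \<le> i \<Longrightarrow> i < q + 5 \<Longrightarrow> p ! i = q + 2"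
    and lo: "\<And>i. q + 5 \<le> i \<Longrightarrow> i < n \<Longrightarrow> p ! i \<le> q"
    using assms by (auto simp: plateau_def)
  show f: "durfee = q + 2"
  proof (rule durfee_eqI)
    fix i assume "i < q + 2"
    then show "q + 2 \<le> p ! i" using hi[of i] mid[of i] by (cases "i < q") auto
  qed (use n mid[of "q + 2"] in auto)
  show "alpha_partition p = map (\<lambda>i. p ! i - i) [0..<q] @ [2, 1]"
    using mid[of q] mid[of "Suc q"] by (simp add: alpha_partition_eq f)
  have col: "col_length p j = q + 5" if "j \<in> {q + 1, q + 2}" for j
  proof (rule antisym)
    show "q + 5 \<le> col_length p j"
      using col_length_iff[of "q + 4" j] mid[of "q + 4"] n that by auto
    show "col_length p j \<le> q + 5"
      using col_length_iff[of "q + 5" j] lo[of "q + 5"] col_length_le[of j] n that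
      by (cases "q + 5 < n") auto
  qed
  obtain g where g: "beta_partition p = map (\<lambda>j. col_length p (Suc j) - Suc j) [0..<g]"
    "g = durfee \<or> Suc g = durfee \<and> col_length p durfee = durfee"
    by (rule beta_partition_eq)
  then have "g = q + 2" using f col[of "q + 2"] by auto
  then show "beta_partition p = map (\<lambda>j. col_length p (Suc j) - Suc j) [0..<q] @ [4, 3]"
    using g(1) col[of "Suc q"] col[of "Suc (Suc q)"] by simp
qed

text \<open>
  The parts 2, 1 of \<open>\<alpha>\<close> give the degree \<open>q + 2\<close> at the positions \<open>q\<close> and \<open>q + 1\<close>; the parts 4, 3 of
  \<open>\<beta>\<close> say that the columns \<open>q + 1\<close> and \<open>q + 2\<close> both have length \<open>q + 5\<close>. So the five rows from \<open>q\<close>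
  on have length \<open>q + 2\<close>, and no later row is longer than \<open>q\<close>. Equal numbers of parts place the two
  pairs at the same position.
\<close>

lemma plateauI:
  assumes "suffix [2, 1] (alpha_partition p)" "suffix [4, 3] (beta_partition p)"
    and "length (alpha_partition p) = length (beta_partition p)"
  obtains q where "plateau q"
proof -
  obtain g where g: "beta_partition p = map (\<lambda>j. col_length p (Suc j) - Suc j) [0..<g]"
    by (rule beta_partition_eq)
  with assms(3) have gf: "g = durfee" by (simp add: alpha_partition_eq)
  obtain as where as: "map (\<lambda>i. p ! i - i) [0..<durfee] = as @ [2, 1]"
    using assms(1) by (auto simp: suffix_def alpha_partition_eq)
  obtain bs where bs: "map (\<lambda>j. col_length p (Suc j) - Suc j) [0..<durfee] = bs @ [4, 3]"
    using assms(2) g gf by (auto simp: suffix_def)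
  define q where "q = length as"
  have f: "durfee = q + 2" using arg_cong[OF as, of length] by (simp add: q_def)
  have q_bs: "length bs = q" using arg_cong[OF bs, of length] f by simp
  have "p ! q - q = 2" "p ! Suc q - Suc q = 1"
    using arg_cong[OF as, of "\<lambda>xs. xs ! q"] arg_cong[OF as, of "\<lambda>xs. xs ! Suc q"] f
    by (auto simp: nth_append q_def simp del: upt_Suc)
  then have pq: "p ! q = q + 2" by linarith
  have "col_length p (Suc q) - Suc q = 4" "col_length p (Suc (Suc q)) - Suc (Suc q) = 3"
    using arg_cong[OF bs, of "\<lambda>xs. xs ! q"] arg_cong[OF bs, of "\<lambda>xs. xs ! Suc q"] f q_bs
    by (auto simp: nth_append simp del: upt_Suc)
  then have col: "col_length p (q + 1) = q + 5" "col_length p (q + 2) = q + 5" by simp_all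
  have n: "q + 5 \<le> n" using col_length_le[of "q + 1"] col by simp
  have "plateau q"
    unfolding plateau_def
  proof (intro conjI allI impI)
    fix i assume "i < q"
    then show "q + 2 \<le> p ! i" using nonincreasing[of i q] pq n by simp
  next
    fix i assume "q \<le> i" "i < q + 5"
    then show "p ! i = q + 2"
      using nonincreasing[of q i] pq n col_length_iff[of i "q + 2"] col by simp
  next
    fix i assume "q + 5 \<le> i" "i < n"
    then show "p ! i \<le> q" using col_length_iff[of i "q + 1"] col by simp
  qed (rule n)
  then show thesis by (rule that)
qed

text \<open>
  Without their last two parts, both partitions consist of their first \<open>q\<close> parts, so that the
  trimmed majorization compares the partial sums at \<open>q\<close>.
\<close>

theorem trimmed_majorization_iff:
  assumes le: "\<And>k. k \<le> durfee \<Longrightarrow> alpha_sum k \<le> beta_sum k"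
  shows "suffix [2, 1] (alpha_partition p) \<and> suffix [4, 3] (beta_partition p)
      \<and> length (alpha_partition p) = length (beta_partition p)
      \<and> drop_smallest_two (beta_partition p) \<succeq> drop_smallest_two (alpha_partition p)
    \<longleftrightarrow> (\<exists>q. plateau q \<and> alpha_sum q = beta_sum q)"
proof -
  have trimmed: "drop_smallest_two (beta_partition p) \<succeq> drop_smallest_two (alpha_partition p)
    \<longleftrightarrow> alpha_sum q = beta_sum q" if "plateau q" for q
  proof -
    note parts = plateau_partitions[OF that]
    have "sum_list (take m (map (\<lambda>i. p ! i - i) [0..<q]))
        \<le> sum_list (take m (map (\<lambda>j. col_length p (Suc j) - Suc j) [0..<q]))" if "m \<le> q" for m
      using le[of m] that parts(1)
      by (simp add: sum_list_take_map_upt alpha_sum_def beta_sum_def)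
    then show ?thesis
      by (auto simp: majorizes_def drop_smallest_two_def parts(2,3) butlast_append
          sum_list_map_upt alpha_sum_def beta_sum_def)
  qed
  show ?thesis
  proof
    assume asm: "suffix [2, 1] (alpha_partition p) \<and> suffix [4, 3] (beta_partition p)
      \<and> length (alpha_partition p) = length (beta_partition p)
      \<and> drop_smallest_two (beta_partition p) \<succeq> drop_smallest_two (alpha_partition p)"
    then obtain q where "plateau q" using plateauI by blast
    then show "\<exists>q. plateau q \<and> alpha_sum q = beta_sum q" using trimmed asm by blast
  next
    assume "\<exists>q. plateau q \<and> alpha_sum q = beta_sum q"
    then obtain q where q: "plateau q" "alpha_sum q = beta_sum q" by blast
    then show "suffix [2, 1] (alpha_partition p) \<and> suffix [4, 3] (beta_partition p)
      \<and> length (alpha_partition p) = length (beta_partition p)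
      \<and> drop_smallest_two (beta_partition p) \<succeq> drop_smallest_two (alpha_partition p)"
      using trimmed[OF q(1)] by (simp add: plateau_partitions[OF q(1)] suffix_def)
  qed
qed

end

section \<open>Erdos-Gallai inequality and split graphs\<close>

lemma sum_eq_iff_pointwise:
  fixes f g :: "'a \<Rightarrow> nat"
  assumes "finite A" "\<And>x. x \<in> A \<Longrightarrow> f x \<le> g x"
  shows "sum f A = sum g A \<longleftrightarrow> (\<forall>x\<in>A. f x = g x)"
  using assms by (metis sum.cong sum_mono_inv)

locale simple_graph =
  fixes V :: "'a set" and adj :: "'a \<Rightarrow> 'a \<Rightarrow> bool"
  assumes finite_V: "finite V"
    and adj_V: "adj u v \<Longrightarrow> v \<in> V"
    and adj_sym: "adj u v \<Longrightarrow> adj v u"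
    and adj_irrefl: "\<not> adj v v"
begin

lemma adj_commute: "adj u v \<longleftrightarrow> adj v u"
  using adj_sym by blast

definition nbrs :: "'a \<Rightarrow> 'a set" where
  "nbrs v = {u. adj v u}"

abbreviation deg :: "'a \<Rightarrow> nat" where
  "deg v \<equiv> card (nbrs v)"

lemma nbrs_subset: "nbrs v \<subseteq> V"
  using adj_V by (auto simp: nbrs_def)

lemma finite_nbrs [simp]: "finite (nbrs v)"
  using nbrs_subset finite_V by (rule finite_subset)

definition clique :: "'a set \<Rightarrow> bool" where
  "clique K \<longleftrightarrow> K \<subseteq> V \<and> (\<forall>u\<in>K. \<forall>v\<in>K. u \<noteq> v \<longrightarrow> adj u v)"

text \<open>
  The sets for which the Erdos-Gallai inequality is an equality.
\<close>

definition tight :: "'a set \<Rightarrow> bool" where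
  "tight K \<longleftrightarrow> clique K \<and> (\<forall>v\<in>V - K. K \<subseteq> nbrs v \<or> nbrs v \<subseteq> K)"

definition split_at :: "'a set \<Rightarrow> bool" where
  "split_at K \<longleftrightarrow> clique K \<and> (\<forall>v\<in>V - K. nbrs v \<subseteq> K)"

text \<open>
  The structure with an induced five-cycle on \<open>C\<close>. A 2-regular graph on five vertices is a
  five-cycle; the degree form is what the degree sequence provides directly.
\<close>

definition regular_core :: "'a set \<Rightarrow> 'a set \<Rightarrow> bool" where
  "regular_core K C \<longleftrightarrow> clique K \<and> C \<subseteq> V - K \<and> card C = 5
     \<and> (\<forall>v\<in>C. K \<subseteq> nbrs v \<and> nbrs v \<subseteq> K \<union> C \<and> card (nbrs v \<inter> C) = 2)
     \<and> (\<forall>v\<in>V - K - C. nbrs v \<subseteq> K)"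

text \<open>
  The remaining inequalities between the four vertices follow from the listed adjacencies. For
  \<open>2K\<^sub>2\<close> and for the five-cycle, all of them do.
\<close>

definition C4_free :: bool where
  "C4_free \<longleftrightarrow> \<not> (\<exists>a b c d. adj a b \<and> adj b c \<and> adj c d \<and> adj d a
     \<and> a \<noteq> c \<and> b \<noteq> d \<and> \<not> adj a c \<and> \<not> adj b d)"

definition two_K2_free :: bool where
  "two_K2_free \<longleftrightarrow> \<not> (\<exists>a b c d. adj a b \<and> adj c d
     \<and> \<not> adj a c \<and> \<not> adj a d \<and> \<not> adj b c \<and> \<not> adj b d)"

definition has_C5 :: bool where
  "has_C5 \<longleftrightarrow> (\<exists>a b c d e. adj a b \<and> adj b c \<and> adj c d \<and> adj d e \<and> adj e a
     \<and> \<not> adj a c \<and> \<not> adj b d \<and> \<not> adj c e \<and> \<not> adj d a \<and> \<not> adj e b)"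

text \<open>
  Double counting of the edges with an end in \<open>K\<close>: each neighbour is attributed to its other end.
\<close>

lemma degree_sum_split:
  assumes "K \<subseteq> V"
  shows "(\<Sum>v\<in>K. deg v)
       = (\<Sum>v\<in>K. card (nbrs v \<inter> K)) + (\<Sum>v\<in>V - K. card (nbrs v \<inter> K))"
proof -
  have cd: "card (nbrs v \<inter> S) = (\<Sum>u\<in>S. if adj v u then 1 else 0)" if "S \<subseteq> V" for v S
  proof -
    have "finite S" using that finite_V finite_subset by blast
    moreover have "nbrs v \<inter> S = S \<inter> {u. adj v u}" by (auto simp: nbrs_def)
    ultimately show ?thesis by (simp add: sum.If_cases)
  qed
  have "(\<Sum>v\<in>K. deg v) = (\<Sum>v\<in>K. card (nbrs v \<inter> V))"
    using nbrs_subset by (simp add: Int_absorb2)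
  also have "\<dots> = (\<Sum>v\<in>K. \<Sum>u\<in>V. if adj v u then 1 else 0)"
    using cd by simp
  also have "\<dots> = (\<Sum>u\<in>V. \<Sum>v\<in>K. if adj u v then 1 else 0)"
    using adj_sym by (subst sum.swap) (intro sum.cong; auto)
  also have "\<dots> = (\<Sum>u\<in>V. card (nbrs u \<inter> K))"
    using cd[OF assms] by simp
  finally show ?thesis
    using sum.subset_diff[OF assms finite_V, of "\<lambda>u. card (nbrs u \<inter> K)"] by simp
qed

text \<open>
  Every vertex of \<open>K\<close> has at most \<open>card K - 1\<close> neighbours in \<open>K\<close>, every other vertex at most \<open>min
  (deg v) (card K)\<close>. Equality holds if and only if each single estimate is attained, which is
  completeness of \<open>K\<close> for the first kind, and one of the two alternatives in the definition of
  \<open>tight\<close> for the second.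
\<close>

theorem erdos_gallai:
  assumes "K \<subseteq> V"
  shows "(\<Sum>v\<in>K. deg v) \<le> card K * (card K - 1) + (\<Sum>v\<in>V - K. min (deg v) (card K))"
    and "(\<Sum>v\<in>K. deg v) = card K * (card K - 1) + (\<Sum>v\<in>V - K. min (deg v) (card K))
      \<longleftrightarrow> tight K"
proof -
  let ?k = "card K"
  have fin: "finite K" using assms finite_V finite_subset by blast
  have in_le: "card (nbrs v \<inter> K) \<le> ?k - 1"
    and in_eq: "card (nbrs v \<inter> K) = ?k - 1 \<longleftrightarrow> K - {v} \<subseteq> nbrs v" if "v \<in> K" for v
  proof -
    have sub: "nbrs v \<inter> K \<subseteq> K - {v}" using adj_irrefl by (auto simp: nbrs_def)
    have card: "card (K - {v}) = ?k - 1" using that fin by simp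
    show "card (nbrs v \<inter> K) \<le> ?k - 1"
      using card_mono[OF _ sub] card fin by simp
    show "card (nbrs v \<inter> K) = ?k - 1 \<longleftrightarrow> K - {v} \<subseteq> nbrs v"
    proof
      assume "card (nbrs v \<inter> K) = ?k - 1"
      then have "nbrs v \<inter> K = K - {v}" using card_subset_eq[OF _ sub] card fin by simp
      then show "K - {v} \<subseteq> nbrs v" by blast
    next
      assume "K - {v} \<subseteq> nbrs v"
      then have "nbrs v \<inter> K = K - {v}" using sub by blast
      then show "card (nbrs v \<inter> K) = ?k - 1" using card by simp
    qed
  qed
  have out_le: "card (nbrs v \<inter> K) \<le> min (deg v) ?k" for v
    using fin by (simp add: card_mono)
  have out_eq: "card (nbrs v \<inter> K) = min (deg v) ?k \<longleftrightarrow> K \<subseteq> nbrs v \<or> nbrs v \<subseteq> K" for v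
  proof
    assume "card (nbrs v \<inter> K) = min (deg v) ?k"
    then have "card (nbrs v \<inter> K) = deg v \<or> card (nbrs v \<inter> K) = ?k" by linarith
    then show "K \<subseteq> nbrs v \<or> nbrs v \<subseteq> K"
      using card_subset_eq[of "nbrs v" "nbrs v \<inter> K"] card_subset_eq[of K "nbrs v \<inter> K"] fin by auto
  next
    assume "K \<subseteq> nbrs v \<or> nbrs v \<subseteq> K"
    then show "card (nbrs v \<inter> K) = min (deg v) ?k"
      using fin card_mono[of "nbrs v" K] card_mono[of K "nbrs v"]
      by (auto simp: Int_absorb1 Int_absorb2)
  qed
  let ?in = "\<Sum>v\<in>K. card (nbrs v \<inter> K)" and ?out = "\<Sum>v\<in>V - K. card (nbrs v \<inter> K)"
  have in_sum: "?in \<le> ?k * (?k - 1)"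
    using sum_mono[of K "\<lambda>v. card (nbrs v \<inter> K)" "\<lambda>_. ?k - 1"] in_le by simp
  have out_sum: "?out \<le> (\<Sum>v\<in>V - K. min (deg v) ?k)"
    using out_le by (rule sum_mono)
  show "(\<Sum>v\<in>K. deg v) \<le> ?k * (?k - 1) + (\<Sum>v\<in>V - K. min (deg v) ?k)"
    using in_sum out_sum degree_sum_split[OF assms] by linarith
  have "(\<Sum>v\<in>K. deg v) = ?k * (?k - 1) + (\<Sum>v\<in>V - K. min (deg v) ?k)
      \<longleftrightarrow> ?in = (\<Sum>v\<in>K. ?k - 1) \<and> ?out = (\<Sum>v\<in>V - K. min (deg v) ?k)"
    using in_sum out_sum degree_sum_split[OF assms] by auto
  also have "\<dots> \<longleftrightarrow> (\<forall>v\<in>K. card (nbrs v \<inter> K) = ?k - 1)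
      \<and> (\<forall>v\<in>V - K. card (nbrs v \<inter> K) = min (deg v) ?k)"
    using sum_eq_iff_pointwise[of K "\<lambda>v. card (nbrs v \<inter> K)" "\<lambda>_. ?k - 1"]
      sum_eq_iff_pointwise[of "V - K" "\<lambda>v. card (nbrs v \<inter> K)" "\<lambda>v. min (deg v) ?k"]
      fin finite_V in_le out_le by simp
  also have "\<dots> \<longleftrightarrow> (\<forall>v\<in>K. K - {v} \<subseteq> nbrs v) \<and> (\<forall>v\<in>V - K. K \<subseteq> nbrs v \<or> nbrs v \<subseteq> K)"
    using in_eq out_eq by simp
  also have "\<dots> \<longleftrightarrow> tight K"
    using assms by (auto simp: tight_def clique_def nbrs_def)
  finally show "(\<Sum>v\<in>K. deg v) = ?k * (?k - 1) + (\<Sum>v\<in>V - K. min (deg v) ?k) \<longleftrightarrow> tight K" .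
qed

lemma clique_subset: "clique K \<Longrightarrow> K \<subseteq> V"
  by (simp add: clique_def)

lemma split_tight: "split_at K \<Longrightarrow> tight K"
  by (auto simp: split_at_def tight_def)

lemma tight_split:
  assumes "tight K" and "\<And>v. v \<in> V - K \<Longrightarrow> deg v \<le> card K"
  shows "split_at K"
proof -
  have "nbrs v \<subseteq> K" if v: "v \<in> V - K" and "K \<subseteq> nbrs v" for v
    using card_subset_eq[of "nbrs v" K] card_mono[of "nbrs v" K] assms(2)[OF v] that(2) by force
  then show ?thesis using assms(1) by (auto simp: tight_def split_at_def)
qed

text \<open>
  If a graph is split at all, then it is split at its vertices of high degree. The reason is that
  \<open>(\<Sum>v\<in>L. deg v) - (\<Sum>v\<in>V - L. deg v) - card L * (card L - 1)\<close> is never positive, vanishes if and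
  only if \<open>L\<close> is a split clique, and is largest for a set \<open>K\<close> as in the hypotheses.
\<close>

lemma split_at_high_degrees:
  assumes K: "K \<subseteq> V"
    and high: "\<And>v. v \<in> K \<Longrightarrow> card K \<le> deg v"
    and low: "\<And>v. v \<in> V - K \<Longrightarrow> deg v \<le> card K"
    and L: "split_at L"
  shows "split_at K"
proof -
  let ?d = "\<lambda>v. int (deg v)"
  define f l where "f = int (card K)" and "l = int (card L)"
  have LV: "L \<subseteq> V" using L by (auto simp: split_at_def clique_def)
  have finK: "finite K" and finL: "finite L" using K LV finite_V finite_subset by blast+
  have pred: "int (card S * (card S - 1)) = int (card S) * (int (card S) - 1)" for S :: "'a set"
    by (cases "card S") (auto simp: algebra_simps)
  have tot: "sum ?d V = sum ?d S + sum ?d (V - S)" if "S \<subseteq> V" for S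
    using sum.subset_diff[OF that finite_V, of ?d] by simp
  have "deg v \<le> card L" if "v \<in> V - L" for v
    using L that finL by (auto simp: split_at_def intro: card_mono)
  then have "(\<Sum>v\<in>V - L. min (deg v) (card L)) = (\<Sum>v\<in>V - L. deg v)"
    by (intro sum.cong) auto
  then have "(\<Sum>v\<in>L. deg v) = card L * (card L - 1) + (\<Sum>v\<in>V - L. deg v)"
    using erdos_gallai(2)[OF LV] split_tight[OF L] by simp
  then have "sum ?d L = int (card L * (card L - 1)) + sum ?d (V - L)"
    by (metis of_nat_add of_nat_sum)
  then have eqL: "sum ?d L = l * (l - 1) + sum ?d (V - L)"
    unfolding pred l_def .
  have minK: "(\<Sum>v\<in>V - K. min (deg v) (card K)) = (\<Sum>v\<in>V - K. deg v)"
    using low by (intro sum.cong) auto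
  then have "(\<Sum>v\<in>K. deg v) \<le> card K * (card K - 1) + (\<Sum>v\<in>V - K. deg v)"
    using erdos_gallai(1)[OF K] by simp
  then have "sum ?d K \<le> int (card K * (card K - 1)) + sum ?d (V - K)"
    by (metis of_nat_add of_nat_le_iff of_nat_sum)
  then have leK: "sum ?d K \<le> f * (f - 1) + sum ?d (V - K)"
    unfolding pred f_def .
  \<comment> \<open>The weight \<open>deg v - f\<close> is nonnegative on \<open>K\<close> and nonpositive elsewhere,
      so no set weighs more than \<open>K\<close>.\<close>
  have "sum (\<lambda>v. ?d v - f) L \<le> sum (\<lambda>v. ?d v - f) (L \<inter> K)"
  proof -
    have "sum (\<lambda>v. ?d v - f) (L - K) \<le> 0"
      using low LV by (intro sum_nonpos) (auto simp: f_def)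
    then show ?thesis
      using sum.Int_Diff[OF finL, of "\<lambda>v. ?d v - f" K] by simp
  qed
  also have "\<dots> \<le> sum (\<lambda>v. ?d v - f) K"
    using high finK by (intro sum_mono2) (auto simp: f_def)
  finally have "sum ?d L - f * l \<le> sum ?d K - f * f"
    by (simp add: sum_subtractf f_def l_def mult.commute)
  \<comment> \<open>A product of two consecutive integers is nonnegative; hence the terms that
      depend on the size only are maximal at size \<open>f\<close>.\<close>
  moreover have "0 \<le> (f - l) * (f - l + 1)"
    by (cases "f - l \<ge> 0") (auto intro: mult_nonneg_nonneg mult_nonpos_nonpos)
  then have "2 * (f * l) - l * (l - 1) \<le> f * f + f"
    by (simp add: algebra_simps)
  ultimately have "f * (f - 1) + sum ?d (V - K) \<le> sum ?d K"
    using eqL tot[OF K] tot[OF LV] by (simp add: algebra_simps)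
  with leK have "sum ?d K = f * (f - 1) + sum ?d (V - K)" by linarith
  then have "sum ?d K = int (card K * (card K - 1)) + sum ?d (V - K)"
    unfolding pred f_def .
  then have "(\<Sum>v\<in>K. deg v) = card K * (card K - 1) + (\<Sum>v\<in>V - K. deg v)"
    by (metis of_nat_add of_nat_eq_iff of_nat_sum)
  then have "tight K" using erdos_gallai(2)[OF K] minK by simp
  then show ?thesis using low by (rule tight_split)
qed

end

section \<open>Graphs without induced four-cycles and pairs of disjoint edges\<close>

context simple_graph
begin

text \<open>
  Call the vertices outside \<open>K \<union> C\<close> independent; all their neighbours are in the clique \<open>K\<close>. An
  induced \<open>C\<^sub>4\<close> cannot use one of them, since its two neighbours on the cycle are not adjacent; nor
  can it use a vertex of \<open>K\<close>, since all nonneighbours of that are independent. An induced \<open>2K\<^sub>2\<close>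
  cannot use a vertex of \<open>K\<close>, since the other edge would join two independent vertices; nor an
  independent one, since its neighbour would be in \<open>K\<close>. So either subgraph lies in \<open>C\<close>, where four
  vertices leave one over; 2-regularity then fails at this fifth vertex, which would have degree 0
  in the case of \<open>C\<^sub>4\<close> and 4 in the case of \<open>2K\<^sub>2\<close>.
\<close>

lemma partition_excludes_C4_two_K2:
  assumes K: "clique K" and CV: "C \<subseteq> V - K"
    and full: "\<And>v. v \<in> C \<Longrightarrow> K \<subseteq> nbrs v \<and> nbrs v \<subseteq> K \<union> C"
    and indep: "\<And>v. v \<in> V - K - C \<Longrightarrow> nbrs v \<subseteq> K"
    and C: "C = {} \<or> card C = 5 \<and> (\<forall>v\<in>C. card (nbrs v \<inter> C) = 2)"
  shows "C4_free" and "two_K2_free"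
proof -
  have V: "u \<in> V \<and> v \<in> V" if "adj u v" for u v
    using that adj_V adj_sym by blast
  have KK: "adj u v" if "u \<in> K" "v \<in> K" "u \<noteq> v" for u v
    using K that by (simp add: clique_def)
  have KC: "adj u v" if "u \<in> K" "v \<in> C" for u v
    using full[of v] that adj_sym by (auto simp: nbrs_def)
  have I: "v \<in> K" if "adj u v" "u \<notin> K" "u \<notin> C" for u v
    using indep[of u] that V[of u v] by (auto simp: nbrs_def)
  have CC: "card (nbrs v \<inter> C) = 2" if "v \<in> C" for v
    using C that by auto
  have fin: "finite C" using CV finite_V by (meson finite_Diff finite_subset)
  have fifth: "\<exists>e\<in>C. e \<notin> {a, b, c, d}" if "a \<in> C" for a b c d
  proof (rule ccontr)
    assume "\<not> ?thesis"
    then have "C \<subseteq> {a, b, c, d}" by blast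
    then have "card C \<le> card {a, b, c, d}" by (intro card_mono) auto
    also have "\<dots> \<le> 4" by (simp add: card_insert_if)
    finally show False using C that by auto
  qed
  have not_three: "\<not> (adj v x \<and> adj v y \<and> adj v z)"
    if "v \<in> C" "x \<in> C" "y \<in> C" "z \<in> C" "x \<noteq> y" "x \<noteq> z" "y \<noteq> z" for v x y z
  proof
    assume "adj v x \<and> adj v y \<and> adj v z"
    then have "{x, y, z} \<subseteq> nbrs v \<inter> C" using that by (auto simp: nbrs_def)
    then have "card {x, y, z} \<le> card (nbrs v \<inter> C)" using fin by (intro card_mono) auto
    then show False using CC[OF that(1)] that by simp
  qed
  have two: "\<exists>x\<in>C. adj v x \<and> x \<noteq> y" if "v \<in> C" for v y
  proof (rule ccontr)
    assume "\<not> ?thesis"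
    then have "nbrs v \<inter> C \<subseteq> {y}" by (auto simp: nbrs_def)
    then have "card (nbrs v \<inter> C) \<le> card {y}" by (intro card_mono) auto
    then show False using CC[OF that] by simp
  qed
  show "C4_free"
    unfolding C4_free_def
  proof
    assume "\<exists>a b c d. adj a b \<and> adj b c \<and> adj c d \<and> adj d a
      \<and> a \<noteq> c \<and> b \<noteq> d \<and> \<not> adj a c \<and> \<not> adj b d"
    then obtain a b c d where e: "adj a b" "adj b c" "adj c d" "adj d a"
      and ne: "a \<noteq> c" "b \<noteq> d" and na: "\<not> adj a c" "\<not> adj b d" by blast
    have inC: "a \<in> C" if "adj a b" "adj b c" "adj c d" "adj d a" "a \<noteq> c" "b \<noteq> d"
      "\<not> adj a c" "\<not> adj b d" for a b c d
    proof (rule ccontr)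
      assume "a \<notin> C"
      show False
      proof (cases "a \<in> K")
        case True
        then have "c \<notin> K" "c \<notin> C" using KK KC that by auto
        then have "b \<in> K" "d \<in> K" using I[of c b] I[of c d] that adj_sym by blast+
        then show False using KK[of b d] that by blast
      next
        case False
        then have "b \<in> K" "d \<in> K" using I[of a b] I[of a d] that adj_sym \<open>a \<notin> C\<close> by blast+
        then show False using KK[of b d] that by blast
      qed
    qed
    have "a \<in> C" "b \<in> C" "c \<in> C" "d \<in> C"
      using inC[of a b c d] inC[of b c d a] inC[of c d a b] inC[of d a b c] e ne na
      by (auto simp: adj_commute)
    obtain x where x: "x \<in> C" "x \<notin> {a, b, c, d}" using fifth \<open>a \<in> C\<close> by blast
    have no: "\<not> adj v x" if "v \<in> {a, b, c, d}" for v
      using that not_three[of a b d x] not_three[of b a c x] not_three[of c b d x] not_three[of d a c x]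
        e x \<open>a \<in> C\<close> \<open>b \<in> C\<close> \<open>c \<in> C\<close> \<open>d \<in> C\<close> ne by (auto simp: adj_commute)
    obtain y where y: "y \<in> C" "adj x y" using two x by blast
    obtain z where z: "z \<in> C" "adj x z" "z \<noteq> y" using two x by blast
    have "y \<notin> {a, b, c, d, x}" "z \<notin> {a, b, c, d, x}" using no y z adj_sym adj_irrefl by blast+
    moreover have "distinct [a, b, c, d]" using e ne adj_irrefl by auto
    ultimately have "card {a, b, c, d, x, y} = 6" using x by auto
    moreover have "{a, b, c, d, x, y} \<subseteq> C" using x y \<open>a \<in> C\<close> \<open>b \<in> C\<close> \<open>c \<in> C\<close> \<open>d \<in> C\<close> by auto
    ultimately have "6 \<le> card C" using fin card_mono by metis
    then show False using C \<open>a \<in> C\<close> by auto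
  qed
  show "two_K2_free"
    unfolding two_K2_free_def
  proof
    assume "\<exists>a b c d. adj a b \<and> adj c d
      \<and> \<not> adj a c \<and> \<not> adj a d \<and> \<not> adj b c \<and> \<not> adj b d"
    then obtain a b c d where e: "adj a b" "adj c d"
      and na: "\<not> adj a c" "\<not> adj a d" "\<not> adj b c" "\<not> adj b d" by blast
    have inC: "a \<in> C" if "adj a b" "adj c d" "\<not> adj a c" "\<not> adj a d" "\<not> adj b c" "\<not> adj b d"
      for a b c d
    proof (rule ccontr)
      assume "a \<notin> C"
      show False
      proof (cases "a \<in> K")
        case True
        have "c \<noteq> a" "d \<noteq> a" using that adj_sym by auto
        then have "c \<notin> K" "c \<notin> C" "d \<notin> K" using True KK KC that by auto
        then show False using I that by blast
      next
        case False
        then have b: "b \<in> K" using I that \<open>a \<notin> C\<close> by blast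
        have "c \<noteq> b" "d \<noteq> b" using that adj_sym by auto
        then have "c \<notin> K" "c \<notin> C" "d \<notin> K" using b KK KC that by auto
        then show False using I that by blast
      qed
    qed
    have "a \<in> C" "b \<in> C" "c \<in> C" "d \<in> C"
      using inC[of a b c d] inC[of b a c d] inC[of c d a b] inC[of d c a b] e na
      by (auto simp: adj_commute)
    have ds: "a \<noteq> b" "a \<noteq> c" "a \<noteq> d" "b \<noteq> c" "b \<noteq> d" "c \<noteq> d"
      using e na adj_irrefl by (auto simp: adj_commute)
    obtain x where x: "x \<in> C" "x \<notin> {a, b, c, d}" using fifth \<open>a \<in> C\<close> by blast
    have "{a, b, c, d, x} \<subseteq> C" using x \<open>a \<in> C\<close> \<open>b \<in> C\<close> \<open>c \<in> C\<close> \<open>d \<in> C\<close> by auto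
    moreover have "card {a, b, c, d, x} = 5" using x ds by auto
    moreover have "card C = 5" using C \<open>a \<in> C\<close> by auto
    ultimately have eq: "C = {a, b, c, d, x}" using fin card_subset_eq by metis
    have "adj a x" using two[OF \<open>a \<in> C\<close>, of b] na adj_irrefl unfolding eq by auto
    moreover have "adj b x" using two[OF \<open>b \<in> C\<close>, of a] na adj_irrefl unfolding eq by auto
    moreover have "adj c x"
      using two[OF \<open>c \<in> C\<close>, of d] na adj_irrefl unfolding eq by (auto simp: adj_commute)
    ultimately show False
      using not_three[of x a b c] x ds \<open>a \<in> C\<close> \<open>b \<in> C\<close> \<open>c \<in> C\<close> by (simp add: adj_commute)
  qed
qed

text \<open>
  The theorem of Foeldes and Hammer. Among all cliques choose \<open>K\<close> with the largest sum of \<open>Suc (deg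
  v)\<close>. The summand \<open>Suc\<close> makes \<open>K\<close> maximal under inclusion, and no replacement of a vertex of \<open>K\<close> by
  others can increase this sum. An edge \<open>x y\<close> outside \<open>K\<close> then leads to one of the three forbidden
  subgraphs. First, the sets of nonneighbours of \<open>x\<close> and \<open>y\<close> in \<open>K\<close> are nested, since otherwise
  there is a \<open>C\<^sub>4\<close>; if that of \<open>x\<close> is the smaller one, it is a single vertex \<open>z\<close>: it is not empty by
  maximality, and two nonneighbours common to \<open>x\<close> and \<open>y\<close> would give a \<open>2K\<^sub>2\<close>. The exchange of \<open>z\<close>
  for \<open>x\<close>, or for both \<open>x\<close> and \<open>y\<close>, then bounds the degree of \<open>z\<close> from below and yields a suitable
  neighbour of \<open>z\<close>.
\<close>

theorem no_C5_split:
  assumes C4: C4_free and K2: two_K2_free and C5: "\<not> has_C5"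
  obtains K where "split_at K"
proof -
  let ?w = "\<lambda>K. \<Sum>v\<in>K. Suc (deg v)"
  have finc: "finite K" if "clique K" for K
    using that finite_V finite_subset by (auto simp: clique_def)
  have "\<exists>K. clique K \<and> (\<forall>L. clique L \<longrightarrow> ?w L \<le> ?w K)"
  proof (rule ex_has_greatest_nat)
    show "clique {}" by (simp add: clique_def)
    have "?w K \<le> ?w V" if "clique K" for K
      using finite_V that by (intro sum_mono2) (auto simp: clique_def)
    then show "\<forall>K. clique K \<longrightarrow> ?w K < Suc (?w V)"
      by (simp add: less_Suc_eq_le)
  qed
  then obtain K where K: "clique K" and max: "\<And>L. clique L \<Longrightarrow> ?w L \<le> ?w K" by blast
  have finK: "finite K" using finc K by blast
  have KV: "K \<subseteq> V" and KK: "\<And>u v. u \<in> K \<Longrightarrow> v \<in> K \<Longrightarrow> u \<noteq> v \<Longrightarrow> adj u v"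
    using K by (auto simp: clique_def)
  have notC4: False if "adj a b" "adj b c" "adj c d" "adj d a" "a \<noteq> c" "b \<noteq> d" "\<not> adj a c" "\<not> adj b d"
    for a b c d using C4 that unfolding C4_free_def by blast
  have not2K2: False if "adj a b" "adj c d" "\<not> adj a c" "\<not> adj a d" "\<not> adj b c" "\<not> adj b d"
    for a b c d using K2 that unfolding two_K2_free_def by blast
  have exch: "?w X \<le> ?w Z" if "Z \<subseteq> K" "X \<subseteq> V - K" "clique (K - Z \<union> X)" for X Z
  proof -
    have "finite X" using that(2) finite_V by (meson finite_Diff finite_subset)
    moreover have "?w (K - Z \<union> X) \<le> ?w K" by (rule max[OF that(3)])
    moreover have "?w (K - Z \<union> X) = ?w (K - Z) + ?w X"
      using that finK \<open>finite X\<close> by (intro sum.union_disjoint) auto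
    moreover have "?w K = ?w (K - Z) + ?w Z"
      using sum.subset_diff[OF that(1) finK] by blast
    ultimately show ?thesis by linarith
  qed
  have False if e: "adj x y" and out: "x \<in> V - K" "y \<in> V - K"
    and sub: "\<And>u. u \<in> K \<Longrightarrow> \<not> adj x u \<Longrightarrow> \<not> adj y u" for x y
  proof -
    have "\<exists>z\<in>K. \<not> adj x z"
    proof (rule ccontr)
      assume "\<not> ?thesis"
      then have "clique (K - {} \<union> {x})" using K out adj_sym by (auto simp: clique_def)
      then have "?w {x} \<le> ?w {}" using exch[of "{}" "{x}"] out by blast
      then show False by simp
    qed
    then obtain z where z: "z \<in> K" "\<not> adj x z" by blast
    then have yz: "\<not> adj y z" using sub by blast
    have x_all: "adj x u" if "u \<in> K" "u \<noteq> z" for u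
      using not2K2[OF e KK[OF z(1) that(1)]] z yz sub that by blast
    have "clique (K - {z} \<union> {x})"
      using K out x_all adj_sym by (auto simp: clique_def)
    then have dxz: "deg x \<le> deg z" using exch[of "{z}" "{x}"] out z by simp
    have zx: "\<not> adj z x" "\<not> adj z y" using z yz adj_sym by blast+
    \<comment> \<open>Otherwise \<open>z t\<close> and \<open>x y\<close> form an induced \<open>2K\<^sub>2\<close>.\<close>
    have t_y: "adj t y" if "adj z t" "\<not> adj x t" for t
      using not2K2[OF e that(1)] that yz z adj_sym by blast
    have "\<exists>t. adj z t \<and> \<not> adj x t"
    proof (rule ccontr)
      assume "\<not> ?thesis"
      then have "nbrs z \<subseteq> nbrs x - {y}" using zx by (auto simp: nbrs_def)
      then have "deg z \<le> card (nbrs x - {y})" by (intro card_mono) auto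
      also have "\<dots> < deg x" using e finite_nbrs[of x] by (intro card_Diff1_less) (auto simp: nbrs_def)
      finally show False using dxz by simp
    qed
    then obtain t where t: "adj z t" "\<not> adj x t" by blast
    have ty: "adj t y" using t_y t by blast
    have "x \<noteq> t" using t zx by blast
    show False
    proof (cases "\<exists>w\<in>K. w \<noteq> z \<and> \<not> adj y w")
      case True
      then obtain w where w: "w \<in> K" "w \<noteq> z" "\<not> adj y w" by blast
      have xw: "adj x w" and zw: "adj z w" using x_all KK w z by auto
      show False
      proof (cases "adj t w")
        case True
        have "w \<noteq> y" using w out by blast
        then show False
          using notC4[of t w x y] True xw e ty w t \<open>x \<noteq> t\<close> by (simp add: adj_commute)
      next
        case False
        have has_C5
          unfolding has_C5_def
          using t ty e xw zw False w z yz
          by (intro exI[of _ t] exI[of _ z] exI[of _ w] exI[of _ x] exI[of _ y])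
            (simp add: adj_commute)
        then show False using C5 by blast
      qed
    next
      case False
      have "x \<noteq> y" using e adj_irrefl by blast
      \<comment> \<open>Now \<open>z\<close> is the only nonneighbour of \<open>y\<close> as well, and it can be exchanged for two
          vertices at once.\<close>
      have "clique (K - {z} \<union> {x, y})"
        using K out x_all False adj_sym e by (auto simp: clique_def)
      then have dxyz: "Suc (deg x + deg y) \<le> deg z"
        using exch[of "{z}" "{x, y}"] out z \<open>x \<noteq> y\<close> by simp
      have "nbrs z \<subseteq> nbrs x \<union> nbrs y"
        using t_y adj_sym by (auto simp: nbrs_def)
      then have "deg z \<le> card (nbrs x \<union> nbrs y)" by (intro card_mono) auto
      also have "\<dots> \<le> deg x + deg y" by (rule card_Un_le)
      finally show False using dxyz by simp
    qed
  qed
  note nested = this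
  have "nbrs x \<subseteq> K" if x: "x \<in> V - K" for x
  proof
    fix y assume "y \<in> nbrs x"
    then have e: "adj x y" by (simp add: nbrs_def)
    show "y \<in> K"
    proof (rule ccontr)
      assume "y \<notin> K"
      with e adj_V have y: "y \<in> V - K" by blast
      obtain u where u: "u \<in> K" "\<not> adj x u" "adj y u" using nested[OF e x y] by blast
      obtain v where v: "v \<in> K" "\<not> adj y v" "adj x v"
        using nested[OF adj_sym[OF e] y x] by blast
      have "u \<noteq> v" using u v by blast
      then show False
        using notC4[of x y u v] e u v KK[of u v] x y by (auto simp: adj_commute)
    qed
  qed
  then have "split_at K" using K by (simp add: split_at_def)
  then show thesis by (rule that)
qed

text \<open>
  A vertex outside an induced five-cycle that is adjacent to one of its vertices is adjacent to the
  next one too, hence to all of them; otherwise one of the forbidden subgraphs appears. Let \<open>K\<close> be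
  the set of the vertices adjacent to the whole cycle. Two nonadjacent vertices of \<open>K\<close> would form a
  \<open>C\<^sub>4\<close> with two nonadjacent vertices of the cycle, and an edge between two vertices without a
  neighbour on the cycle would form a \<open>2K\<^sub>2\<close> with an edge of the cycle.
\<close>

theorem C5_regular_core:
  assumes C4: C4_free and K2: two_K2_free and C5: has_C5
  obtains K C where "regular_core K C"
proof -
  have notC4: False if "adj a b" "adj b c" "adj c d" "adj d a" "a \<noteq> c" "b \<noteq> d" "\<not> adj a c" "\<not> adj b d"
    for a b c d using C4 that unfolding C4_free_def by blast
  have not2K2: False if "adj a b" "adj c d" "\<not> adj a c" "\<not> adj a d" "\<not> adj b c" "\<not> adj b d"
    for a b c d using K2 that unfolding two_K2_free_def by blast
  define cyc where "cyc a b c d e \<longleftrightarrow> adj a b \<and> adj b c \<and> adj c d \<and> adj d e \<and> adj e a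
     \<and> \<not> adj a c \<and> \<not> adj b d \<and> \<not> adj c e \<and> \<not> adj d a \<and> \<not> adj e b" for a b c d e
  have rot: "cyc b c d e a" if "cyc a b c d e" for a b c d e
    using that unfolding cyc_def by blast
  have step: "adj v b" if "cyc a b c d e" "v \<notin> {a, b, c, d, e}" "adj v a" for a b c d e v
  proof (rule ccontr)
    assume nb: "\<not> adj v b"
    have A: "adj a b" "adj b c" "adj c d" "adj d e" "adj e a"
     "\<not> adj a c" "\<not> adj b d" "\<not> adj c e" "\<not> adj d a" "\<not> adj e b" using that(1) by (auto simp: cyc_def)
    have S: "adj b a" "adj c b" "adj d c" "adj e d" "adj a e"
     "\<not> adj c a" "\<not> adj d b" "\<not> adj e c" "\<not> adj a d" "\<not> adj b e" "adj a v" "\<not> adj b v" using A nb that(3) adj_sym by blast+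
    have nc: "\<not> adj v c" using notC4[of v a b c] A S that nb adj_commute[of v c] by auto
    have nd: "adj v d" using not2K2[of v a c d] A S that nc by blast
    have "\<not> adj v e" using not2K2[of v e b c] A S that nb nc by blast
    then show False using notC4[of v a e d] A S that nd adj_commute[of v d] by auto
  qed
  from C5 obtain a b c d e where cy: "cyc a b c d e" unfolding has_C5_def cyc_def by blast
  have A: "adj a b" "adj b c" "adj c d" "adj d e" "adj e a"
     "\<not> adj a c" "\<not> adj b d" "\<not> adj c e" "\<not> adj d a" "\<not> adj e b" using cy by (auto simp: cyc_def)
  have S: "adj b a" "adj c b" "adj d c" "adj e d" "adj a e"
     "\<not> adj c a" "\<not> adj d b" "\<not> adj e c" "\<not> adj a d" "\<not> adj b e" using A adj_sym by blast+
  have ds: "distinct [a, b, c, d, e]"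
    using A S adj_irrefl by auto
  define C where "C = {a, b, c, d, e}"
  define K where "K = {v \<in> V - C. adj v a}"
  have steps: "adj v a \<Longrightarrow> adj v b" "adj v b \<Longrightarrow> adj v c" "adj v c \<Longrightarrow> adj v d"
    "adj v d \<Longrightarrow> adj v e" "adj v e \<Longrightarrow> adj v a" if "v \<notin> C" for v
    using step[OF cy, of v] step[OF rot[OF cy], of v] step[OF rot[OF rot[OF cy]], of v]
      step[OF rot[OF rot[OF rot[OF cy]]], of v] step[OF rot[OF rot[OF rot[OF rot[OF cy]]]], of v]
      that unfolding C_def by auto
  have K_all: "adj v x" if "v \<in> K" "x \<in> C" for v x
    using that steps[of v] unfolding K_def C_def by blast
  have K_none: "\<not> adj v x" if "v \<notin> K" "v \<in> V - C" "x \<in> C" for v x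
    using that steps[of v] unfolding K_def C_def by blast
  have CV: "C \<subseteq> V" using A adj_V unfolding C_def by blast
  have 1: "clique K"
    unfolding clique_def
  proof (intro conjI ballI impI)
    show "K \<subseteq> V" by (auto simp: K_def)
    fix u v assume uv: "u \<in> K" "v \<in> K" "u \<noteq> v"
    have "adj u a" "adj u c" "adj v a" "adj v c" "a \<noteq> c"
      using uv K_all ds by (auto simp: C_def)
    then show "adj u v"
      using notC4[of u a v c] uv A adj_commute[of u v] adj_commute[of v a] adj_commute[of u c]
      by blast
  qed
  have 2: "C \<subseteq> V - K" using CV by (auto simp: K_def)
  have 3: "card C = 5" using ds by (simp add: C_def)
  have 4: "K \<subseteq> nbrs v \<and> nbrs v \<subseteq> K \<union> C \<and> card (nbrs v \<inter> C) = 2" if "v \<in> C" for v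
  proof (intro conjI)
    show "K \<subseteq> nbrs v" using K_all that adj_sym by (auto simp: nbrs_def)
    show "nbrs v \<subseteq> K \<union> C" using K_none that adj_sym adj_V by (force simp: nbrs_def)
    have eqs: "nbrs a \<inter> C = {b, e}" "nbrs b \<inter> C = {a, c}" "nbrs c \<inter> C = {b, d}"
      "nbrs d \<inter> C = {c, e}" "nbrs e \<inter> C = {a, d}"
      using A S adj_irrefl by (auto simp: nbrs_def C_def)
    have "v = a \<or> v = b \<or> v = c \<or> v = d \<or> v = e" using that by (simp add: C_def)
    then show "card (nbrs v \<inter> C) = 2" using ds by (elim disjE) (simp_all add: eqs)
  qed
  have 5: "nbrs v \<subseteq> K" if v: "v \<in> V - K - C" for v
  proof
    fix u assume "u \<in> nbrs v"
    then have e: "adj v u" by (simp add: nbrs_def)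
    have nv: "\<not> adj v x" if "x \<in> C" for x using K_none v that by blast
    show "u \<in> K"
    proof (rule ccontr)
      assume "u \<notin> K"
      moreover have "u \<in> V - C" using e adj_V nv by blast
      ultimately have "\<not> adj u x" if "x \<in> C" for x using K_none that by blast
      then show False using not2K2[of v u a b] e nv A by (auto simp: C_def)
    qed
  qed
  have "regular_core K C"
    unfolding regular_core_def using 1 2 3 4 5 by (intro conjI ballI) simp_all
  then show thesis by (rule that)
qed

theorem forbidden_subgraph_characterization:
  "C4_free \<and> two_K2_free \<longleftrightarrow> (\<exists>K. split_at K) \<or> (\<exists>K C. regular_core K C)"
proof
  assume "C4_free \<and> two_K2_free"
  then show "(\<exists>K. split_at K) \<or> (\<exists>K C. regular_core K C)"
    by (metis no_C5_split C5_regular_core)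
next
  assume "(\<exists>K. split_at K) \<or> (\<exists>K C. regular_core K C)"
  then show "C4_free \<and> two_K2_free"
  proof
    assume "\<exists>K. split_at K"
    then obtain K where "split_at K" by blast
    then show ?thesis using partition_excludes_C4_two_K2[of K "{}"] by (auto simp: split_at_def)
  next
    assume "\<exists>K C. regular_core K C"
    then obtain K C where "regular_core K C" by blast
    then show ?thesis using partition_excludes_C4_two_K2[of K C] by (auto simp: regular_core_def)
  qed
qed

end

section \<open>Reading the structure off the degree sequence\<close>

text \<open>
  Listing the vertices by decreasing degree lets initial segments of the degree sequence be read as
  vertex sets.
\<close>

locale degree_ordered_graph = simple_graph +
  fixes vs :: "'a list"
  assumes distinct_vs: "distinct vs"
    and set_vs: "set vs = V"
    and degrees_decrease: "i \<le> j \<Longrightarrow> j < length vs \<Longrightarrow> deg (vs ! j) \<le> deg (vs ! i)"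
begin

abbreviation degs :: "nat list" where
  "degs \<equiv> map deg vs"

sublocale nonincreasing_list degs
  using degrees_decrease by unfold_locales auto

definition leaders :: "nat \<Rightarrow> 'a set" where
  "leaders k = set (take k vs)"

lemma leaders_eq_image: "k \<le> length vs \<Longrightarrow> leaders k = (!) vs ` {..<k}"
  by (simp add: leaders_def atLeast0LessThan flip: nth_image)

lemma rest_eq_image:
  assumes "k \<le> length vs"
  shows "V - leaders k = (!) vs ` {k..<length vs}"
proof -
  have "V = (!) vs ` {..<length vs}"
    using leaders_eq_image[of "length vs"] set_vs by (simp add: leaders_def)
  then have "V - leaders k = (!) vs ` {..<length vs} - (!) vs ` {..<k}"
    using leaders_eq_image[OF assms] by simp
  also have "\<dots> = (!) vs ` ({..<length vs} - {..<k})"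
    using assms inj_on_nth[OF distinct_vs, of "{..<length vs}"]
    by (intro inj_on_image_set_diff[symmetric]) auto
  also have "{..<length vs} - {..<k} = {k..<length vs}" by auto
  finally show ?thesis .
qed

lemma leaders_subset: "leaders k \<subseteq> V"
  using set_take_subset[of k vs] by (simp add: leaders_def set_vs)

lemma card_leaders: "k \<le> length vs \<Longrightarrow> card (leaders k) = k"
  using distinct_vs by (simp add: leaders_def distinct_card)

lemma inj_vs: "S \<subseteq> {..<length vs} \<Longrightarrow> inj_on ((!) vs) S"
  using distinct_vs by (intro inj_on_nth) auto

lemma sum_leaders: "k \<le> length vs \<Longrightarrow> (\<Sum>v\<in>leaders k. h v) = (\<Sum>i<k. h (vs ! i))"
  by (simp add: leaders_eq_image sum.reindex inj_vs)

lemma sum_rest: "k \<le> length vs \<Longrightarrow> (\<Sum>v\<in>V - leaders k. h v) = (\<Sum>i = k..<length vs. h (vs ! i))"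
  by (subst rest_eq_image) (auto simp: sum.reindex inj_vs subset_iff)

text \<open>
  Ties in the degrees make the initial segments depend on the list, but a set separated from its
  complement by a strict gap in the degrees is an initial segment of every such list.
\<close>

lemma leaders_eqI:
  assumes "S \<subseteq> V" and "\<And>u v. u \<in> S \<Longrightarrow> v \<in> V - S \<Longrightarrow> deg v < deg u"
  shows "leaders (card S) = S"
proof (rule ccontr)
  assume ne: "leaders (card S) \<noteq> S"
  have len: "card S \<le> length vs"
    using assms(1) distinct_vs set_vs by (metis List.finite_set card_mono distinct_card)
  have fin: "finite S" using assms(1) finite_V finite_subset by blast
  have "\<not> S \<subseteq> leaders (card S)"
    using ne card_leaders[OF len] card_subset_eq[of "leaders (card S)" S] by (auto simp: leaders_def)
  then obtain u where u: "u \<in> S" "u \<in> V - leaders (card S)" using assms(1) by blast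
  have "\<not> leaders (card S) \<subseteq> S"
    using ne card_leaders[OF len] card_subset_eq[OF fin, of "leaders (card S)"] by auto
  then obtain v where v: "v \<in> leaders (card S)" "v \<in> V - S" using leaders_subset by blast
  obtain i where i: "i < card S" "v = vs ! i" using v leaders_eq_image[OF len] by auto
  obtain j where j: "card S \<le> j" "j < length vs" "u = vs ! j" using u rest_eq_image[OF len] by auto
  have "deg u \<le> deg v" using degrees_decrease[of i j] i j by simp
  then show False using assms(2) u v by fastforce
qed

text \<open>
  The slack of the Erdos-Gallai inequality at the first \<open>k\<close> vertices is the difference of the
  partial sums of the two partitions.
\<close>

theorem partial_sums:
  assumes "k \<le> durfee"
  shows "alpha_sum k \<le> beta_sum k" and "alpha_sum k = beta_sum k \<longleftrightarrow> tight (leaders k)"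
proof -
  have k: "k \<le> length vs" using assms durfee_le by simp
  have "(\<Sum>i<k. degs ! i) = (\<Sum>v\<in>leaders k. deg v)"
    using k by (simp add: sum_leaders)
  moreover have "(\<Sum>i = k..<length degs. min (degs ! i) k) = (\<Sum>v\<in>V - leaders k. min (deg v) k)"
    using k by (simp add: sum_rest)
  ultimately have "alpha_sum k + (k * (k - 1) + (\<Sum>v\<in>V - leaders k. min (deg v) k))
      = beta_sum k + (\<Sum>v\<in>leaders k. deg v)"
    using partition_sums_balance[OF assms] unfolding alpha_sum_def beta_sum_def by simp
  then show "alpha_sum k \<le> beta_sum k" and "alpha_sum k = beta_sum k \<longleftrightarrow> tight (leaders k)"
    using erdos_gallai[OF leaders_subset[of k]] card_leaders[OF k] by auto
qed

text \<open>
  The first \<open>durfee\<close> vertices have degree at least \<open>durfee\<close> and the others at most \<open>durfee\<close>; so for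
  this set tightness means split, and it is a split clique as soon as there is one.
\<close>

theorem split_iff_majorizes:
  "(\<exists>K. split_at K) \<longleftrightarrow> beta_partition degs \<succeq> alpha_partition degs"
proof -
  have f: "durfee \<le> length vs" using durfee_le by simp
  have high: "durfee \<le> deg v" if "v \<in> leaders durfee" for v
    using that durfee_le_nth f by (auto simp: leaders_eq_image)
  have low: "deg v \<le> durfee" if "v \<in> V - leaders durfee" for v
    using that nth_le_durfee f by (auto simp: rest_eq_image)
  have "(\<exists>K. split_at K) \<longleftrightarrow> tight (leaders durfee)"
  proof
    assume "\<exists>K. split_at K"
    then obtain L where "split_at L" by blast
    then have "split_at (leaders durfee)"
      using split_at_high_degrees[OF leaders_subset] high low card_leaders[OF f] by metis
    then show "tight (leaders durfee)" by (rule split_tight)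
  next
    assume "tight (leaders durfee)"
    then show "\<exists>K. split_at K" using tight_split low card_leaders[OF f] by metis
  qed
  then show ?thesis
    using beta_majorizes_alpha_iff partial_sums by simp
qed

lemma regular_core_degrees:
  assumes "regular_core K C"
  shows "v \<in> K \<Longrightarrow> card K + 4 \<le> deg v"
    and "v \<in> C \<Longrightarrow> deg v = card K + 2"
    and "v \<in> V - K - C \<Longrightarrow> deg v \<le> card K"
proof -
  have core: "clique K" "C \<subseteq> V - K" "card C = 5"
    and mid: "\<And>v. v \<in> C \<Longrightarrow> K \<subseteq> nbrs v \<and> nbrs v \<subseteq> K \<union> C \<and> card (nbrs v \<inter> C) = 2"
    and out: "\<And>v. v \<in> V - K - C \<Longrightarrow> nbrs v \<subseteq> K"
    using assms by (auto simp: regular_core_def)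
  have KV: "K \<subseteq> V" using core(1) by (rule clique_subset)
  have fin: "finite K" "finite C" using KV core(2) finite_V by (meson finite_Diff finite_subset)+
  have disj: "K \<inter> C = {}" using core(2) by blast
  show "card K + 4 \<le> deg v" if v: "v \<in> K"
  proof -
    have "(K - {v}) \<union> C \<subseteq> nbrs v"
    proof
      fix x assume x: "x \<in> (K - {v}) \<union> C"
      show "x \<in> nbrs v"
      proof (cases "x \<in> C")
        case True
        then have "v \<in> nbrs x" using mid v by blast
        then show ?thesis using adj_sym by (simp add: nbrs_def)
      next
        case False
        then show ?thesis using x v core(1) by (auto simp: clique_def nbrs_def)
      qed
    qed
    then have "card ((K - {v}) \<union> C) \<le> deg v" by (intro card_mono) auto
    moreover have "card ((K - {v}) \<union> C) = card (K - {v}) + 5"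
      using fin disj core(3) by (subst card_Un_disjoint) auto
    moreover have "Suc (card (K - {v})) = card K" using fin(1) v by (rule card_Suc_Diff1)
    ultimately show ?thesis by linarith
  qed
  show "deg v = card K + 2" if v: "v \<in> C"
  proof -
    have "nbrs v = K \<union> (nbrs v \<inter> C)" using mid[OF v] by blast
    then have "deg v = card (K \<union> (nbrs v \<inter> C))" by simp
    also have "\<dots> = card K + card (nbrs v \<inter> C)"
      using fin disj by (intro card_Un_disjoint) auto
    finally show ?thesis using mid[OF v] by simp
  qed
  show "deg v \<le> card K" if "v \<in> V - K - C"
    using out[OF that] fin by (intro card_mono) auto
qed

text \<open>
  The degrees separate \<open>K\<close>, \<open>C\<close> and the independent set strictly, so that these are consecutive
  segments of the list.
\<close>

lemma regular_core_plateau: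
  assumes core: "regular_core K C"
  shows "plateau (card K)" and "tight (leaders (card K))"
proof -
  let ?q = "card K"
  note deg = regular_core_degrees[OF core]
  have K: "K \<subseteq> V" "clique K" and C: "C \<subseteq> V - K" "card C = 5"
    using core by (auto simp: regular_core_def clique_def)
  have fin: "finite K" "finite C" using K C finite_V by (meson finite_Diff finite_subset)+
  have topK: "leaders ?q = K"
  proof (rule leaders_eqI)
    fix u v assume "u \<in> K" "v \<in> V - K"
    then show "deg v < deg u" using deg(1)[of u] deg(2)[of v] deg(3)[of v] by fastforce
  qed (rule K)
  have "card (K \<union> C) = ?q + 5" using fin C by (subst card_Un_disjoint) auto
  moreover have "leaders (card (K \<union> C)) = K \<union> C"
  proof (rule leaders_eqI)
    fix u v assume "u \<in> K \<union> C" "v \<in> V - (K \<union> C)"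
    then show "deg v < deg u" using deg(1)[of u] deg(2)[of u] deg(3)[of v] by fastforce
  qed (use K C in blast)
  ultimately have topKC: "leaders (?q + 5) = K \<union> C" by simp
  have len: "?q + 5 \<le> length vs"
    using \<open>card (K \<union> C) = ?q + 5\<close> card_mono[OF finite_V, of "K \<union> C"] K C distinct_card[OF distinct_vs] set_vs
    by auto
  have inK: "vs ! i \<in> K" if "i < ?q" for i
    using that topK len leaders_eq_image[of ?q] by auto
  have notK: "vs ! i \<in> V - K" if "?q \<le> i" "i < length vs" for i
    using that topK len rest_eq_image[of ?q] by auto
  have inKC: "vs ! i \<in> K \<union> C" if "i < ?q + 5" for i
    using that topKC len leaders_eq_image[of "?q + 5"] by auto
  have notKC: "vs ! i \<in> V - (K \<union> C)" if "?q + 5 \<le> i" "i < length vs" for i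
    using that topKC len rest_eq_image[of "?q + 5"] by auto
  show "plateau ?q"
    unfolding plateau_def
  proof (intro conjI allI impI)
    fix i assume "i < ?q"
    then show "?q + 2 \<le> degs ! i" using deg(1)[OF inK[of i]] len by simp
  next
    fix i assume i: "?q \<le> i" "i < ?q + 5"
    then have "vs ! i \<in> C" using notK[of i] inKC[of i] len by auto
    then show "degs ! i = ?q + 2" using deg(2) i len by simp
  next
    fix i assume "?q + 5 \<le> i" "i < length degs"
    then show "degs ! i \<le> ?q" using deg(3)[of "vs ! i"] notKC[of i] by auto
  qed (use len in simp)
  show "tight (leaders ?q)"
    unfolding topK tight_def using core by (auto simp: regular_core_def)
qed

text \<open>
  The five vertices of degree \<open>q + 2\<close> are too large in degree to have all their neighbours in
  \<open>leaders q\<close>, so tightness makes them adjacent to all of it; the vertices of degree at most \<open>q\<close>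
  have all their neighbours there. This leaves two neighbours within the five for each of them.
\<close>

lemma plateau_regular_core:
  assumes plat: "plateau q" and tight: "tight (leaders q)"
  shows "regular_core (leaders q) (leaders (q + 5) - leaders q)"
proof -
  let ?K = "leaders q" and ?C = "leaders (q + 5) - leaders q"
  have len: "q + 5 \<le> length vs"
    and mid: "\<And>i. q \<le> i \<Longrightarrow> i < q + 5 \<Longrightarrow> degs ! i = q + 2"
    and lo: "\<And>i. q + 5 \<le> i \<Longrightarrow> i < length degs \<Longrightarrow> degs ! i \<le> q"
    using plat by (auto simp: plateau_def)
  have cardK: "card ?K = q" using card_leaders len by simp
  have finK: "finite ?K" by (simp add: leaders_def)
  have sub: "?K \<subseteq> leaders (q + 5)"
    unfolding leaders_def by (rule set_take_subset_set_take) simp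
  have degC: "deg v = q + 2" if "v \<in> ?C" for v
  proof -
    have "v \<in> V - ?K" "v \<in> leaders (q + 5)" using that leaders_subset by blast+
    obtain i where i: "v = vs ! i" "q \<le> i" "i < length vs"
      using \<open>v \<in> V - ?K\<close> rest_eq_image[of q] len by auto
    moreover obtain j where j: "v = vs ! j" "j < q + 5"
      using \<open>v \<in> leaders (q + 5)\<close> leaders_eq_image[of "q + 5"] len by auto
    ultimately have "i = j" using distinct_vs len by (simp add: nth_eq_iff_index_eq)
    then show ?thesis using mid[of i] i j len by simp
  qed
  have degI: "deg v \<le> q" if "v \<in> V - ?K - ?C" for v
  proof -
    have "v \<in> V - leaders (q + 5)" using that by blast
    then obtain i where "v = vs ! i" "q + 5 \<le> i" "i < length vs"
      using rest_eq_image[of "q + 5"] len by auto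
    then show ?thesis using lo[of i] by simp
  qed
  have clique: "clique ?K" and outer: "\<And>v. v \<in> V - ?K \<Longrightarrow> ?K \<subseteq> nbrs v \<or> nbrs v \<subseteq> ?K"
    using tight by (auto simp: tight_def)
  have I: "nbrs v \<subseteq> ?K" if v: "v \<in> V - ?K - ?C" for v
  proof (cases "?K \<subseteq> nbrs v")
    case True
    then have "?K = nbrs v"
      using degI[OF v] cardK card_mono[OF finite_nbrs True] by (intro card_subset_eq) auto
    then show ?thesis by simp
  qed (use outer v in blast)
  have C: "?K \<subseteq> nbrs v" "nbrs v \<subseteq> ?K \<union> ?C" "card (nbrs v \<inter> ?C) = 2" if v: "v \<in> ?C" for v
  proof -
    have "\<not> nbrs v \<subseteq> ?K"
      using degC[OF v] cardK card_mono[OF finK, of "nbrs v"] by auto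
    moreover have "v \<in> V - ?K" using v leaders_subset by blast
    ultimately show K: "?K \<subseteq> nbrs v" using outer by blast
    show KC: "nbrs v \<subseteq> ?K \<union> ?C"
    proof
      fix u assume u: "u \<in> nbrs v"
      show "u \<in> ?K \<union> ?C"
      proof (rule ccontr)
        assume "u \<notin> ?K \<union> ?C"
        then have "nbrs u \<subseteq> ?K" using I u nbrs_subset by blast
        moreover have "v \<in> nbrs u" using u adj_sym by (simp add: nbrs_def)
        ultimately show False using v by blast
      qed
    qed
    have "nbrs v = ?K \<union> (nbrs v \<inter> ?C)" using K KC by blast
    moreover have "card (?K \<union> (nbrs v \<inter> ?C)) = card ?K + card (nbrs v \<inter> ?C)"
      using finK by (intro card_Un_disjoint) auto
    ultimately show "card (nbrs v \<inter> ?C) = 2" using degC[OF v] cardK by simp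
  qed
  have "card ?C = 5"
    using card_leaders len sub finK by (simp add: card_Diff_subset)
  moreover have "?C \<subseteq> V - ?K" using leaders_subset by blast
  ultimately show ?thesis
    unfolding regular_core_def using clique I C by (intro conjI ballI) simp_all
qed

theorem regular_core_iff_trimmed_majorizes:
  "(\<exists>K C. regular_core K C) \<longleftrightarrow>
    suffix [2, 1] (alpha_partition degs) \<and> suffix [4, 3] (beta_partition degs)
    \<and> length (alpha_partition degs) = length (beta_partition degs)
    \<and> drop_smallest_two (beta_partition degs) \<succeq> drop_smallest_two (alpha_partition degs)"
proof -
  have "(\<exists>K C. regular_core K C) \<longleftrightarrow> (\<exists>q. plateau q \<and> tight (leaders q))"
    using regular_core_plateau plateau_regular_core by metis
  also have "\<dots> \<longleftrightarrow> (\<exists>q. plateau q \<and> alpha_sum q = beta_sum q)"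
    using partial_sums(2) plateau_partitions(1) by (metis le_add1)
  finally show ?thesis
    using trimmed_majorization_iff partial_sums(1) by simp
qed

end

section \<open>Transfer to symmetric digraphs\<close>

text \<open>
  An isomorphism from an induced subgraph amounts to an injective map in the opposite direction that
  preserves and reflects adjacency, since there are no parallel arcs: an arc is determined by its
  ends.
\<close>

lemma (in graph) contains_induced_pair_iff:
  assumes ends: "parcs P \<subseteq> pverts P \<times> pverts P"
  shows "contains_induced G (with_proj P) \<longleftrightarrow>
    (\<exists>f. inj_on f (pverts P) \<and> f ` pverts P \<subseteq> verts G \<and>
      (\<forall>x\<in>pverts P. \<forall>y\<in>pverts P. f x \<rightarrow>\<^bsub>G\<^esub> f y \<longleftrightarrow> (x, y) \<in> parcs P))"
proof
  assume "contains_induced G (with_proj P)"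
  then obtain H h where H: "induced_subgraph H G" and h: "pre_digraph.digraph_isomorphism H h"
    and P: "with_proj P = app_iso h H"
    by (auto simp: contains_induced_def digraph_iso_def)
  from H have sub: "verts H \<subseteq> verts G" and th: "tail H = tail G" "head H = head G"
    and arcsH: "arcs H = {e \<in> arcs G. tail G e \<in> verts H \<and> head G e \<in> verts H}"
    by (auto simp: induced_subgraph_def subgraph_def compatible_def)
  have vP: "pverts P = iso_verts h ` verts H" and aP: "parcs P = iso_arcs h ` arcs H"
    and ft: "iso_tail h = fst" "iso_head h = snd"
    using arg_cong[OF P, of verts] arg_cong[OF P, of arcs] arg_cong[OF P, of tail]
      arg_cong[OF P, of head] by simp_all
  have inj: "inj_on (iso_verts h) (verts H)"
    and arc: "\<And>a. a \<in> arcs H \<Longrightarrow> iso_arcs h a = (iso_verts h (tail G a), iso_verts h (head G a))"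
    using h by (auto simp: pre_digraph.digraph_isomorphism_def ft th prod_eq_iff)
  define f where "f = the_inv_into (verts H) (iso_verts h)"
  have f: "f (iso_verts h u) = u" if "u \<in> verts H" for u
    using inj that by (simp add: f_def the_inv_into_f_f)
  have "iso_verts h u = iso_verts h v \<longleftrightarrow> u = v" if "u \<in> verts H" "v \<in> verts H" for u v
    using inj that by (auto dest: inj_onD)
  then have "u \<rightarrow>\<^bsub>G\<^esub> v \<longleftrightarrow> (iso_verts h u, iso_verts h v) \<in> parcs P"
    if "u \<in> verts H" "v \<in> verts H" for u v
    using that by (auto simp: arcs_ends_conv aP arc arcsH image_iff)
  then show "\<exists>f. inj_on f (pverts P) \<and> f ` pverts P \<subseteq> verts G \<and>
      (\<forall>x\<in>pverts P. \<forall>y\<in>pverts P. f x \<rightarrow>\<^bsub>G\<^esub> f y \<longleftrightarrow> (x, y) \<in> parcs P)"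
    using f sub by (intro exI[of _ f]) (auto simp: vP inj_on_def)
next
  assume "\<exists>f. inj_on f (pverts P) \<and> f ` pverts P \<subseteq> verts G \<and>
      (\<forall>x\<in>pverts P. \<forall>y\<in>pverts P. f x \<rightarrow>\<^bsub>G\<^esub> f y \<longleftrightarrow> (x, y) \<in> parcs P)"
  then obtain f where inj: "inj_on f (pverts P)" and fG: "f ` pverts P \<subseteq> verts G"
    and f: "\<And>x y. x \<in> pverts P \<Longrightarrow> y \<in> pverts P \<Longrightarrow> f x \<rightarrow>\<^bsub>G\<^esub> f y \<longleftrightarrow> (x, y) \<in> parcs P"
    by blast
  define H where "H = G \<restriction> (f ` pverts P)"
  define g where "g = the_inv_into (pverts P) f"
  have g: "g (f x) = x" if "x \<in> pverts P" for x
    using inj that by (simp add: g_def the_inv_into_f_f)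
  define h where "h = \<lparr>iso_verts = g, iso_arcs = (\<lambda>a. (g (tail G a), g (head G a))),
    iso_head = snd, iso_tail = fst\<rparr>"
  have ind: "induced_subgraph H G"
    unfolding H_def using fG by (rule induced_induce)
  have wf: "wf_digraph H" using ind by (auto simp: induced_subgraph_def subgraph_def)
  have injg: "inj_on g (f ` pverts P)" using g by (auto simp: inj_on_def)
  have "a = b" if "a \<in> arcs H" "b \<in> arcs H" "g (tail G a) = g (tail G b)" "g (head G a) = g (head G b)"
    for a b
  proof -
    have "tail G a = tail G b" "head G a = head G b"
      using that injg by (auto simp: H_def dest: inj_onD)
    then show ?thesis using that no_multi_arcs[of a b] by (auto simp: H_def arc_to_ends_def)
  qed
  then have iso: "pre_digraph.digraph_isomorphism H h"
    using wf injg
    by (auto simp: pre_digraph.digraph_isomorphism_def h_def H_def inj_on_def)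
  have "g ` f ` pverts P = pverts P" using g by (auto simp: image_image)
  moreover have "(\<lambda>a. (g (tail G a), g (head G a))) ` arcs H = parcs P"
  proof (intro equalityI subsetI)
    fix e assume "e \<in> (\<lambda>a. (g (tail G a), g (head G a))) ` arcs H"
    then obtain a x y where a: "a \<in> arcs G" "tail G a = f x" "head G a = f y"
      and xy: "x \<in> pverts P" "y \<in> pverts P" and e: "e = (g (tail G a), g (head G a))"
      by (auto simp: H_def)
    have "f x \<rightarrow>\<^bsub>G\<^esub> f y" using a by (intro dominatesI[of a]) (auto simp: arc_to_ends_def)
    then show "e \<in> parcs P" using e a g xy f by simp
  next
    fix e assume "e \<in> parcs P"
    then obtain x y where e: "e = (x, y)" and xy: "x \<in> pverts P" "y \<in> pverts P" using ends by blast
    then have "f x \<rightarrow>\<^bsub>G\<^esub> f y" using f \<open>e \<in> parcs P\<close> by simp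
    then obtain a where "a \<in> arcs G" "tail G a = f x" "head G a = f y" by blast
    then show "e \<in> (\<lambda>a. (g (tail G a), g (head G a))) ` arcs H"
      using e xy g by (auto simp: H_def image_iff intro!: bexI[of _ a])
  qed
  ultimately have "with_proj P = app_iso h H"
    by (simp add: with_proj_def app_iso_def h_def H_def)
  then show "contains_induced G (with_proj P)"
    using ind iso by (auto simp: contains_induced_def digraph_iso_def)
qed

text \<open>
  Replaces embeddings of the vertex set \<open>{0, 1, 2, 3}\<close> by quadruples of vertices.
\<close>

lemma ex_nat_tuple4:
  "(\<exists>f :: nat \<Rightarrow> 'a. Q (f 0) (f 1) (f 2) (f 3)) \<longleftrightarrow> (\<exists>a b c d. Q a b c d)"
proof
  assume "\<exists>a b c d. Q a b c d"
  then obtain a b c d where "Q a b c d" by blast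
  then show "\<exists>f :: nat \<Rightarrow> 'a. Q (f 0) (f 1) (f 2) (f 3)"
    by (intro exI[of _ "\<lambda>n. [a, b, c, d] ! n"]) (simp add: numeral_eq_Suc)
qed blast

context graph
begin

lemma simple_graph: "simple_graph (verts G) (dominates G)"
  using adj_in_verts adj_not_same arcs_ends_symmetric[OF sym_arcs]
  by unfold_locales auto

interpretation simple: simple_graph "verts G" "dominates G"
  by (rule simple_graph)

lemma contains_C4_iff: "contains_induced G C4 \<longleftrightarrow> \<not> simple.C4_free"
proof -
  have "contains_induced G C4 \<longleftrightarrow> (\<exists>f :: nat \<Rightarrow> 'a. distinct [f 0, f 1, f 2, f 3]
      \<and> {f 0, f 1, f 2, f 3} \<subseteq> verts G
      \<and> f 0 \<rightarrow>\<^bsub>G\<^esub> f 1 \<and> f 1 \<rightarrow>\<^bsub>G\<^esub> f 2 \<and> f 2 \<rightarrow>\<^bsub>G\<^esub> f 3 \<and> f 3 \<rightarrow>\<^bsub>G\<^esub> f 0 \<and> \<not> f 0 \<rightarrow>\<^bsub>G\<^esub> f 2 \<and> \<not> f 1 \<rightarrow>\<^bsub>G\<^esub> f 3)"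
    unfolding C4_def
    by (subst contains_induced_pair_iff, simp, rule ex_cong1)
      (auto simp: inj_on_def simple.adj_irrefl simple.adj_commute)
  also have "\<dots> \<longleftrightarrow> (\<exists>a b c d. distinct [a, b, c, d] \<and> {a, b, c, d} \<subseteq> verts G
      \<and> a \<rightarrow>\<^bsub>G\<^esub> b \<and> b \<rightarrow>\<^bsub>G\<^esub> c \<and> c \<rightarrow>\<^bsub>G\<^esub> d \<and> d \<rightarrow>\<^bsub>G\<^esub> a \<and> \<not> a \<rightarrow>\<^bsub>G\<^esub> c \<and> \<not> b \<rightarrow>\<^bsub>G\<^esub> d)"
    by (rule ex_nat_tuple4)
  also have "\<dots> \<longleftrightarrow> \<not> simple.C4_free"
    unfolding simple.C4_free_def not_not
    by (intro ex_cong1) (auto dest: adj_in_verts adj_not_same)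
  finally show ?thesis .
qed

lemma contains_two_K2_iff: "contains_induced G two_K2 \<longleftrightarrow> \<not> simple.two_K2_free"
proof -
  have "contains_induced G two_K2 \<longleftrightarrow> (\<exists>f :: nat \<Rightarrow> 'a. distinct [f 0, f 1, f 2, f 3]
      \<and> {f 0, f 1, f 2, f 3} \<subseteq> verts G \<and> f 0 \<rightarrow>\<^bsub>G\<^esub> f 1 \<and> f 2 \<rightarrow>\<^bsub>G\<^esub> f 3
      \<and> \<not> f 0 \<rightarrow>\<^bsub>G\<^esub> f 2 \<and> \<not> f 0 \<rightarrow>\<^bsub>G\<^esub> f 3 \<and> \<not> f 1 \<rightarrow>\<^bsub>G\<^esub> f 2 \<and> \<not> f 1 \<rightarrow>\<^bsub>G\<^esub> f 3)"
    unfolding two_K2_def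
    by (subst contains_induced_pair_iff, simp, rule ex_cong1)
      (auto simp: inj_on_def simple.adj_irrefl simple.adj_commute)
  also have "\<dots> \<longleftrightarrow> (\<exists>a b c d. distinct [a, b, c, d] \<and> {a, b, c, d} \<subseteq> verts G \<and> a \<rightarrow>\<^bsub>G\<^esub> b \<and> c \<rightarrow>\<^bsub>G\<^esub> d
      \<and> \<not> a \<rightarrow>\<^bsub>G\<^esub> c \<and> \<not> a \<rightarrow>\<^bsub>G\<^esub> d \<and> \<not> b \<rightarrow>\<^bsub>G\<^esub> c \<and> \<not> b \<rightarrow>\<^bsub>G\<^esub> d)"
    by (rule ex_nat_tuple4)
  also have "\<dots> \<longleftrightarrow> \<not> simple.two_K2_free"
    unfolding simple.two_K2_free_def not_not
    by (intro ex_cong1) (auto dest: adj_in_verts adj_not_same simple.adj_sym)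
  finally show ?thesis .
qed

lemma out_degree_eq_card_nbrs: "out_degree G v = card (simple.nbrs v)"
proof -
  have "inj_on (head G) (out_arcs G v)"
    using no_multi_arcs by (auto simp: inj_on_def arc_to_ends_def)
  then have "out_degree G v = card (head G ` out_arcs G v)"
    by (simp add: out_degree_def card_image)
  moreover have "head G ` out_arcs G v = simple.nbrs v"
    unfolding simple.nbrs_def by (auto simp: arcs_ends_conv image_iff)
  ultimately show ?thesis by simp
qed

lemma obtain_degree_order:
  obtains vs where "degree_ordered_graph (verts G) (dominates G) vs"
    and "degree_seq G = map (\<lambda>v. card (simple.nbrs v)) vs"
proof -
  let ?deg = "\<lambda>v. card (simple.nbrs v)"
  obtain us where us: "set us = verts G" "distinct us"
    using finite_distinct_list[OF finite_verts] by blast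
  define vs where "vs = rev (sort_key ?deg us)"
  have sorted: "sorted (rev (map ?deg vs))"
    by (simp add: vs_def rev_map)
  have "mset (map ?deg vs) = image_mset (out_degree G) (mset_set (verts G))"
    using us by (simp add: vs_def out_degree_eq_card_nbrs[abs_def] mset_set_set[symmetric])
  then have "sort (rev (map ?deg vs))
      = sorted_list_of_multiset (image_mset (out_degree G) (mset_set (verts G)))"
    by (metis mset_rev sorted_list_of_multiset_mset)
  then have "rev (map ?deg vs)
      = sorted_list_of_multiset (image_mset (out_degree G) (mset_set (verts G)))"
    using sorted_sort_id[OF sorted] by simp
  then have "degree_seq G = map ?deg vs"
    unfolding degree_seq_def by (metis rev_rev_ident)
  moreover have "degree_ordered_graph (verts G) (dominates G) vs"
  proof unfold_locales
    fix i j assume "i \<le> j" "j < length vs"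
    then show "?deg (vs ! j) \<le> ?deg (vs ! i)"
      using sorted_rev_nth_mono[OF sorted, of i j] by simp
  qed (use us in \<open>auto simp: vs_def\<close>)
  ultimately show thesis using that by blast
qed

end

theorem corollary6p2:
  fixes G :: "('a,'b) pre_digraph" and \<pi> :: "nat list"
  assumes "graph G" and "verts G \<noteq> {}"
    and no_isolated: "\<forall>v \<in> verts G. out_degree G v \<noteq> 0"
    and deg: "\<pi> = degree_seq G"
  shows "pseudo_split G \<longleftrightarrow>
    beta_partition \<pi> \<succeq> alpha_partition \<pi> \<or>
    (suffix [2,1] (alpha_partition \<pi>) \<and>
     suffix [4,3] (beta_partition \<pi>) \<and>
     length (alpha_partition \<pi>) = length (beta_partition \<pi>) \<and>
     drop_smallest_two (beta_partition \<pi>) \<succeq> drop_smallest_two (alpha_partition \<pi>))"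
proof -
  interpret graph G by fact
  obtain vs where order: "degree_ordered_graph (verts G) (dominates G) vs"
    and seq: "degree_seq G = map (\<lambda>v. card (simple_graph.nbrs (dominates G) v)) vs"
    by (rule obtain_degree_order)
  interpret degree_ordered_graph "verts G" "dominates G" vs by (rule order)
  have \<pi>: "\<pi> = degs" using deg seq by simp
  have "pseudo_split G \<longleftrightarrow> C4_free \<and> two_K2_free"
    by (simp add: pseudo_split_def contains_C4_iff contains_two_K2_iff)
  also have "\<dots> \<longleftrightarrow> (\<exists>K. split_at K) \<or> (\<exists>K C. regular_core K C)"
    by (rule forbidden_subgraph_characterization)
  finally show ?thesis
    unfolding split_iff_majorizes regular_core_iff_trimmed_majorizes \<pi> .
qed

end
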